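(* For almost all (in the sense of Lebesgue measure) positive $c \in \mathbb{R}\setminus\mathbb{Z}$, we have $$\limsup_{N\to\infty} \frac{\Upsilon_c(N)}{c N^{1/c}/\log^2 N} \geqslant 1,$$ where $N$ runs over the positive integers.
   Context: $\lfloor t\rfloor$ is the greatest integer $\leqslant t$. For a real number $c>0$ and a positive integer $N$, $\Upsilon_c(N)$ denotes the number of pairs of primes $(p,q)$ with $N = \lfloor p^c\rfloor + q$ (equivalently, the number of primes $p$ such that $N-\lfloor p^c\rfloor$ is prime). "Almost all" means that the set of exceptional $c$ has Lebesgue measure zero. *)

theory Defs
  imports "HOL-Analysis.Analysis" "HOL-Computational_Algebra.Primes"
begin

text \<open>The equation is stated over the integers, so there is no truncated subtraction.
  For \<open>c > 0\<close> the set below is finite, so \<open>card\<close> is the actual number of pairs.\<close>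

definition Upsilon :: "real \<Rightarrow> nat \<Rightarrow> nat" where
  "Upsilon c N = card {(p :: nat, q :: nat). prime p \<and> prime q \<and>
     int N = \<lfloor>real p powr c\<rfloor> + int q}"

end

theory Submission
  imports Defs "HOL-Complex_Analysis.Complex_Analysis" "HOL-Number_Theory.Prime_Powers"
    "HOL-Real_Asymp.Real_Asymp"
begin

text \<open>The lower bound holds for every \<open>c > 0\<close>, by averaging. Counting only primes \<open>p\<close> with
  \<open>p\<^sup>c \<le> X\<close>, the sum of \<open>\<Upsilon>\<^sub>c(N)\<close> over \<open>X < N \<le> (1 + \<eta>) X\<close> is at least the number of pairs \<open>(p, q)\<close> with
  \<open>q\<close> in a window of length \<open>\<eta> X\<close> starting at \<open>X - \<lfloor>p\<^sup>c\<rfloor> \<ge> 0\<close>. By the prime number theorem each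
  window contains about \<open>\<eta> X / log X\<close> primes and there are about \<open>c X\<^bsup>1/c\<^esup> / log X\<close> choices of \<open>p\<close>, so
  the mean value is asymptotically at least \<open>c X\<^bsup>1/c\<^esup> / log\<^sup>2 X\<close>, and one lets \<open>\<eta>\<close> tend to \<open>0\<close>.

  The prime number theorem is obtained by Newman's method: \<open>\<psi>(n) - n = O(n)\<close> by Chebyshev, and the
  transform \<open>\<integral> (\<psi>(x) - \<lfloor>x\<rfloor>) x\<^bsup>-s-1\<^esup> dx = - (\<zeta>'(s) / \<zeta>(s) + \<zeta>(s)) / s\<close> continues analytically across the
  line \<open>Re s = 1\<close>, because \<open>\<zeta>\<close> has no zeros there. Hence the integral converges at \<open>s = 1\<close>, and as \<open>\<psi>\<close> is
  monotone, \<open>\<psi>(n) \<sim> n\<close>.\<close>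

section \<open>Newman's Tauberian theorem\<close>

text \<open>\<open>npow x s\<close> is \<open>x\<^bsup>-s\<^esup>\<close>, written with the real logarithm so that no branch conditions arise.\<close>
definition npow :: "real \<Rightarrow> complex \<Rightarrow> complex" where
  "npow x s = exp (- (s * of_real (ln x)))"

lemma norm_npow: "x > 0 \<Longrightarrow> norm (npow x s) = x powr (- Re s)"
  by (simp add: npow_def norm_exp_eq_Re powr_def)

lemma npow_add: "npow x (s + t) = npow x s * npow x t"
  by (simp add: npow_def exp_add [symmetric] algebra_simps)

lemma npow_mult: "x > 0 \<Longrightarrow> y > 0 \<Longrightarrow> npow (x * y) s = npow x s * npow y s"
  by (simp add: npow_def exp_add [symmetric] ln_mult algebra_simps)

lemma npow_1_left [simp]: "npow 1 s = 1"
  by (simp add: npow_def)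

lemma npow_1_right: "x > 0 \<Longrightarrow> npow x 1 = 1 / of_real x"
  by (simp add: npow_def exp_minus exp_of_real inverse_eq_divide)

lemma npow_derivative_exponent:
  "((\<lambda>s. npow x s) has_field_derivative - of_real (ln x) * npow x s) (at s within A)"
  unfolding npow_def by (auto intro!: derivative_eq_intros)

lemma npow_holomorphic: "npow x holomorphic_on A"
  unfolding npow_def by (intro holomorphic_intros)

lemma npow_derivative_base:
  assumes "x > 0"
  shows "((\<lambda>x. npow x s) has_vector_derivative - s * npow x (s + 1)) (at x within A)"
proof -
  have "((\<lambda>x. ln x) has_vector_derivative 1 / x) (at x within A)"
    unfolding has_real_derivative_iff_has_vector_derivative [symmetric]
    using assms by (auto intro!: derivative_eq_intros simp: divide_inverse)
  hence "((\<lambda>x. - (s * of_real (ln x))) has_vector_derivative - (s * of_real (1 / x))) (at x within A)"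
    using assms by (auto intro!: derivative_eq_intros)
  from field_vector_diff_chain_within[OF this, of exp "npow x s"]
  have "((\<lambda>x. npow x s) has_vector_derivative - (s * of_real (1 / x)) * npow x s) (at x within A)"
    unfolding npow_def o_def by (simp add: DERIV_exp has_field_derivative_at_within)
  thus ?thesis using assms by (simp add: npow_add npow_1_right mult_ac)
qed

text \<open>Summed against \<open>b n\<close>, the weights give the integral of b(floor x) x^(-z-2)
  over x >= 1, so the improper integral of Newman's method becomes a series. Writing z = s - 1 puts
  the line Re s = 1 on the imaginary axis.\<close>

definition newman_weight :: "nat \<Rightarrow> complex \<Rightarrow> complex" where
  "newman_weight n z = integral {real n..real n + 1} (\<lambda>x. npow x (z + 2))"

lemma continuous_npow_base: "continuous_on {0<..} (\<lambda>x. npow x s)"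
  unfolding npow_def by (auto intro!: continuous_intros)

lemma newman_weight_eq:
  assumes "n \<ge> 1"
  shows "(z + 1) * newman_weight n z = npow n (z + 1) - npow (real n + 1) (z + 1)"
proof -
  have "((\<lambda>x. - (z + 1) * npow x (z + 1 + 1)) has_integral 
           npow (real n + 1) (z + 1) - npow n (z + 1)) {real n..real n + 1}"
    by (intro fundamental_theorem_of_calculus npow_derivative_base) (use assms in auto)
  moreover have "(\<lambda>x. npow x (z + 2)) integrable_on {real n..real n + 1}"
    using assms by (auto intro!: integrable_continuous_real continuous_on_subset[OF continuous_npow_base])
  from has_integral_mult_right[OF integrable_integral[OF this], of "- (z + 1)"]
  have "((\<lambda>x. - (z + 1) * npow x (z + 1 + 1)) has_integral - (z + 1) * newman_weight n z) {real n..real n + 1}"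
    by (simp add: newman_weight_def add.assoc)
  ultimately
  have "npow (real n + 1) (z + 1) - npow n (z + 1) = - (z + 1) * newman_weight n z"
    by (rule has_integral_unique)
  thus ?thesis by (simp add: algebra_simps)
qed

lemma newman_weight_holomorphic:
  assumes "n \<ge> 1"
  shows "newman_weight n holomorphic_on UNIV"
  unfolding newman_weight_def cbox_interval [symmetric]
proof (rule leibniz_rule_holomorphic)
  show "((\<lambda>z. npow t (z + 2)) has_field_derivative - of_real (ln t) * npow t (z + 2)) (at z within UNIV)" 
    for z t unfolding npow_def by (auto intro!: derivative_eq_intros)
  show "(\<lambda>x. npow x (z + 2)) integrable_on cbox (real n) (real n + 1)" for z
    using assms by (auto intro!: integrable_continuous_real continuous_on_subset[OF continuous_npow_base])
  show "continuous_on (UNIV \<times> cbox (real n) (real n + 1)) (\<lambda>(z, t). - of_real (ln t) * npow t (z + 2))"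
    unfolding npow_def case_prod_unfold using assms by (auto intro!: continuous_intros)
qed auto

text \<open>One factor 1/x of |x^(-z-2)| is replaced by 1/n; what remains integrates exactly and
  telescopes in n. Both signs of Re z are allowed: positive ones serve the tails of the series,
  negative ones its partial sums.\<close>

lemma norm_newman_weight_le:
  assumes n: "n \<ge> 1" and z: "Re z \<noteq> 0"
  shows "real n * norm (newman_weight n z) \<le> (n powr (- Re z) - (real n + 1) powr (- Re z)) / Re z"
proof -
  define \<sigma> where "\<sigma> = Re z"
  have *: "((\<lambda>x. x powr (- \<sigma> - 1)) has_integral 
      (- ((real n + 1) powr (- \<sigma>) / \<sigma>) - (- (n powr (- \<sigma>) / \<sigma>)))) {real n..real n + 1}"
    by (intro fundamental_theorem_of_calculus)
       (use n z in \<open>auto intro!: derivative_eq_intros simp: \<sigma>_def simp flip: has_real_derivative_iff_has_vector_derivative\<close>)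
  have "norm (newman_weight n z) \<le> integral {real n..real n + 1} (\<lambda>x. x powr (- \<sigma> - 1) / n)"
    unfolding newman_weight_def
  proof (rule integral_norm_bound_integral)
    show "(\<lambda>x. npow x (z + 2)) integrable_on {real n..real n + 1}"
      using n by (auto intro!: integrable_continuous_real continuous_on_subset[OF continuous_npow_base])
    show "(\<lambda>x. x powr (- \<sigma> - 1) / n) integrable_on {real n..real n + 1}"
      using * by (intro integrable_on_divide) blast
    fix x assume x: "x \<in> {real n..real n + 1}"
    hence x0: "x > 0" using n by auto
    have "norm (npow x (z + 2)) = x powr (- \<sigma> - 1) / x"
      using x0 by (simp add: norm_npow \<sigma>_def powr_diff powr_minus powr_add power2_eq_square field_simps)
    also have "\<dots> \<le> x powr (- \<sigma> - 1) / n"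
      using x n by (intro divide_left_mono) auto
    finally show "norm (npow x (z + 2)) \<le> x powr (- \<sigma> - 1) / n" .
  qed
  also have "\<dots> = (n powr (- \<sigma>) - (real n + 1) powr (- \<sigma>)) / \<sigma> / n"
    using integral_unique[OF *] by (simp add: diff_divide_distrib)
  finally have "real n * norm (newman_weight n z) \<le> 
      real n * ((n powr (- \<sigma>) - (real n + 1) powr (- \<sigma>)) / \<sigma> / n)"
    by (intro mult_left_mono) auto
  thus ?thesis using n by (simp add: \<sigma>_def)
qed

section \<open>Cauchy's formula on two half circles\<close>

text \<open>On the circle R^2 = z * cnj z, so the kernel is the real number 2 Re z / R^2.\<close>

lemma circle_kernel:
  assumes "norm z = R" "R > 0"
  shows "norm ((1 + z\<^sup>2 / of_real R ^ 2) / z) = 2 * \<bar>Re z\<bar> / R\<^sup>2"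
proof -
  have "z * cnj z = of_real R ^ 2"
    using assms by (metis complex_norm_square of_real_power)
  hence "(1 + z\<^sup>2 / of_real R ^ 2) / z = (z + cnj z) / of_real R ^ 2"
    using assms by (auto simp: field_simps power2_eq_square) 
  also have "\<dots> = of_real (2 * Re z / R\<^sup>2)"
    by (simp add: complex_add_cnj)
  finally show ?thesis by (simp add: norm_mult norm_divide norm_power)
qed

lemma path_image_right_half_circle:
  assumes "R > 0" "z \<in> path_image (part_circlepath 0 R (-pi/2) (pi/2))"
  shows "norm z = R" "Re z \<ge> 0"
  using assms by (auto simp: path_image_part_circlepath norm_mult Re_exp intro!: mult_nonneg_nonneg cos_ge_zero)

lemma path_image_left_half_circle:
  assumes "R > 0" "z \<in> path_image (part_circlepath 0 R (pi/2) (3*pi/2))"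
  shows "norm z = R" "Re z \<le> 0"
proof -
  have "cos x \<le> 0" if "pi / 2 \<le> x" "x \<le> 3 * pi / 2" for x
    using cos_ge_zero[of "x - pi"] that by (simp add: field_simps)
  thus "norm z = R" "Re z \<le> 0"
    using assms by (auto simp: path_image_part_circlepath norm_mult Re_exp mult_nonneg_nonpos)
qed

lemma circle_imaginary_points:
  assumes "norm z = R" "Re z = 0" "R > 0"
  shows "z \<in> {\<i> * of_real R, - \<i> * of_real R}"
proof -
  have "\<bar>Im z\<bar> = R" using assms by (simp add: cmod_def)
  thus ?thesis using assms by (auto simp: complex_eq_iff abs_if split: if_splits)
qed

lemma half_circle_endpoints:
  "pathstart (part_circlepath 0 R (-pi/2) (pi/2)) = - \<i> * of_real R"
  "pathfinish (part_circlepath 0 R (-pi/2) (pi/2)) = \<i> * of_real R"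
  "pathstart (part_circlepath 0 R (pi/2) (3*pi/2)) = \<i> * of_real R"
  "pathfinish (part_circlepath 0 R (pi/2) (3*pi/2)) = - \<i> * of_real R"
proof -
  have "cos (3*pi/2) = 0" "sin (3*pi/2) = -1"
    using cos_periodic_pi[of "pi/2"] sin_periodic_pi[of "pi/2"] by (simp_all add: add.commute)
  thus "pathstart (part_circlepath 0 R (-pi/2) (pi/2)) = - \<i> * of_real R"
  "pathfinish (part_circlepath 0 R (-pi/2) (pi/2)) = \<i> * of_real R"
  "pathstart (part_circlepath 0 R (pi/2) (3*pi/2)) = \<i> * of_real R"
  "pathfinish (part_circlepath 0 R (pi/2) (3*pi/2)) = - \<i> * of_real R"
    by (auto simp: complex_eq_iff Re_exp Im_exp)
qed

text \<open>With w = R exp(i u) the form dw / w is i du, so only the angle swept matters.\<close>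

lemma winding_number_part_circlepath_centre:
  assumes "s < t" "R > 0"
  shows "winding_number (part_circlepath 0 R s t) 0 = of_real ((t - s) / (2 * pi))"
proof -
  have "0 \<notin> path_image (part_circlepath 0 R s t)"
    using assms by (auto simp: path_image_part_circlepath)
  hence "winding_number (part_circlepath 0 R s t) 0 =
      1 / (2 * pi * \<i>) * contour_integral (part_circlepath 0 R s t) (\<lambda>w. 1 / (w - 0))"
    by (intro winding_number_valid_path) auto
  also have "contour_integral (part_circlepath 0 R s t) (\<lambda>w. 1 / (w - 0)) = \<i> * of_real (t - s)"
    using assms by (subst contour_integral_part_circlepath_eq) (auto simp: field_simps scaleR_conv_of_real)
  also have "1 / (2 * pi * \<i>) * (\<i> * of_real (t - s)) = of_real ((t - s) / (2 * pi))"
    by simp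
  finally show ?thesis .
qed

text \<open>Each half circle has winding number 1/2 around 0. The halves stay separate because
  \<open>S\<close> will be estimated differently on each of them.\<close>

lemma Cauchy_formula_two_half_circles:
  assumes S: "S holomorphic_on UNIV" and R: "R > 0"
  shows "contour_integral (part_circlepath 0 R (-pi/2) (pi/2)) (\<lambda>z. S z / z) +
         contour_integral (part_circlepath 0 R (pi/2) (3*pi/2)) (\<lambda>z. S z / z) = 2 * pi * \<i> * S 0"
proof -
  let ?A = "part_circlepath 0 R (-pi/2) (pi/2)" and ?A' = "part_circlepath 0 R (pi/2) (3*pi/2)"
  have 0: "0 \<notin> path_image ?A" "0 \<notin> path_image ?A'"
    using path_image_right_half_circle(1)[OF R, of 0] path_image_left_half_circle(1)[OF R, of 0] R by auto
  have int: "(\<lambda>z. S z / z) contour_integrable_on ?A" "(\<lambda>z. S z / z) contour_integrable_on ?A'"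
    using 0 by (auto intro!: contour_integrable_continuous_part_circlepath holomorphic_on_imp_continuous_on
        holomorphic_on_divide holomorphic_on_subset[OF S])
  have join: "pathfinish ?A = pathstart ?A'"
    by (simp only: half_circle_endpoints)
  have "winding_number (?A +++ ?A') 0 = winding_number ?A 0 + winding_number ?A' 0"
    by (intro winding_number_join 0 join) auto
  also have "\<dots> = 1"
    using R by (simp add: winding_number_part_circlepath_centre field_simps)
  finally have w: "winding_number (?A +++ ?A') 0 = 1" .
  have "((\<lambda>w. S w / (w - 0)) has_contour_integral (2*pi * \<i> * winding_number (?A +++ ?A') 0 * S 0)) (?A +++ ?A')"
  proof (rule Cauchy_integral_formula_convex_simple[OF _ S])
    show "valid_path (?A +++ ?A')" by (intro valid_path_join join) auto
    show "path_image (?A +++ ?A') \<subseteq> UNIV - {0}" using 0 path_image_join_subset by blast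
    show "pathfinish (?A +++ ?A') = pathstart (?A +++ ?A')"
      by (simp only: pathfinish_join pathstart_join half_circle_endpoints)
  qed auto
  hence "contour_integral (?A +++ ?A') (\<lambda>z. S z / z) = 2 * pi * \<i> * S 0"
    unfolding w by (simp add: contour_integral_unique)
  thus ?thesis
    by (subst (asm) contour_integral_join) (use int in auto)
qed

text \<open>The factor \<open>1 + z\<^sup>2 / R\<^sup>2\<close> is small enough near \<open>\<plusminus>iR\<close> to absorb the singularity \<open>1 / Re z\<close> of the bounds
  on both half circles. It also vanishes at \<open>\<plusminus>iR\<close>, so that integrating by parts along the segment from
  \<open>iR\<close> to \<open>-iR\<close> leaves no boundary terms and gives the error \<open>C / L\<close>.\<close>
lemma newman_contour_estimate:
  assumes U: "open U" "{z. Re z \<ge> 0} \<subseteq> U" and f: "f holomorphic_on U" and R: "R > 0"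
  obtains C where "\<And>S B L. L > 0 \<Longrightarrow> B \<ge> 0 \<Longrightarrow> S holomorphic_on UNIV \<Longrightarrow>
    (\<And>z. norm z = R \<Longrightarrow> Re z > 0 \<Longrightarrow> norm (S z - f z) \<le> B * exp (- (L * Re z)) / Re z) \<Longrightarrow>
    (\<And>z. norm z = R \<Longrightarrow> Re z < 0 \<Longrightarrow> norm (S z) \<le> B * exp (- (L * Re z)) / \<bar>Re z\<bar>) \<Longrightarrow>
    norm (S 0 - f 0) \<le> 2 * B / R + C / L"
proof -
  let ?A = "part_circlepath 0 R (-pi/2) (pi/2)" and ?A' = "part_circlepath 0 R (pi/2) (3*pi/2)"
  let ?seg = "linepath (\<i> * of_real R) (- \<i> * of_real R)"
  \<comment> \<open>The difference quotient removes the pole of (f z - f 0) / z at 0, so that the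
    right arc can be deformed to the segment through 0.\<close>
  define F where "F = (\<lambda>z. if z = 0 then deriv f 0 else (f z - f 0) / (z - 0))"
  define K :: "complex \<Rightarrow> complex" where "K = (\<lambda>z. 1 + z\<^sup>2 / of_real R ^ 2)"
  define G where "G = (\<lambda>z. F z * K z)"
  have "0 \<in> U" using U by auto
  hence "F holomorphic_on U"
    unfolding F_def using U by (intro pole_lemma f) (auto simp: interior_open)
  hence G: "G holomorphic_on U"
    unfolding G_def K_def using R by (intro holomorphic_intros) auto
  hence G': "deriv G holomorphic_on U"
    using U by (intro holomorphic_deriv)
  have seg: "path_image ?seg \<subseteq> {z. Re z = 0}"
    by (auto simp: closed_segment_def)
  hence segU: "path_image ?seg \<subseteq> U" using U(2) by force
  have "compact (deriv G ` path_image ?seg)"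
    by (intro compact_continuous_image holomorphic_on_imp_continuous_on holomorphic_on_subset[OF G' segU] compact_path_image) auto
  then obtain C0 where C0: "\<And>z. z \<in> path_image ?seg \<Longrightarrow> norm (deriv G z) \<le> C0"
    by (meson compact_imp_bounded bounded_iff imageI)
  have "0 \<le> C0"
    using C0[of "pathstart ?seg"] norm_ge_zero order_trans pathstart_in_path_image by blast

  have G_bound: "norm (contour_integral ?A (\<lambda>z. G z * exp (of_real L * z))) \<le> 2 * R * C0 / L" if L: "L > 0" for L
  proof -
    let ?E = "\<lambda>z. exp (of_real L * z) :: complex"
    let ?P = "\<lambda>z. G z * ?E z" and ?D = "\<lambda>z. deriv G z * ?E z"
    have P: "?P holomorphic_on U" and D: "?D holomorphic_on U" 
      by (intro holomorphic_intros G G')+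
    have Pc: "continuous_on X ?P" "continuous_on X ?D" if "X \<subseteq> U" for X
      using that P D holomorphic_on_subset by (blast intro: holomorphic_on_imp_continuous_on)+
    have "K (\<i> * of_real R) = 0" "K (- \<i> * of_real R) = 0"
      using R by (simp_all add: K_def power_mult_distrib)
    hence G0: "G (\<i> * of_real R) = 0" "G (- \<i> * of_real R) = 0"
      by (simp_all add: G_def)
    have "((\<lambda>z. ?D z + of_real L * ?P z) has_contour_integral
            (?P (pathfinish ?seg) - ?P (pathstart ?seg))) ?seg"
    proof (rule contour_integral_primitive[OF _ _ segU])
      fix z assume "z \<in> U"
      hence "(G has_field_derivative deriv G z) (at z within U)"
        using G U(1) holomorphic_derivI by blast
      thus "(?P has_field_derivative ?D z + of_real L * ?P z) (at z within U)"
        by (auto intro!: derivative_eq_intros simp: algebra_simps)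
    qed auto
    hence *: "((\<lambda>z. ?D z + of_real L * ?P z) has_contour_integral 0) ?seg"
      using G0 by simp
    have Di: "(?D has_contour_integral contour_integral ?seg ?D) ?seg"
      by (intro has_contour_integral_integral contour_integrable_continuous_linepath Pc)
         (use segU in simp)
    have "((\<lambda>z. of_real L * ?P z) has_contour_integral - contour_integral ?seg ?D) ?seg"
      using has_contour_integral_diff[OF * Di] by simp
    from has_contour_integral_lmul[OF this, of "1 / of_real L"]
    have seg_int: "(?P has_contour_integral - contour_integral ?seg ?D / of_real L) ?seg"
      using L by simp
    have "norm (contour_integral ?seg ?D) \<le> C0 * norm (- \<i> * of_real R - \<i> * of_real R)"
    proof (rule has_contour_integral_bound_linepath[OF Di \<open>C0 \<ge> 0\<close>])
      fix z assume z: "z \<in> closed_segment (\<i> * of_real R) (- \<i> * of_real R)"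
      hence "Re z = 0" using seg by auto
      thus "norm (?D z) \<le> C0" using C0[of z] z by (simp add: norm_mult norm_exp_eq_Re)
    qed
    also have "norm (- \<i> * of_real R - \<i> * of_real R) = 2 * R"
      using R by (simp add: norm_mult flip: minus_add_distrib mult_2)
    finally have seg_bound: "norm (contour_integral ?seg ?D) \<le> 2 * R * C0" by (simp add: mult_ac)

    have join: "pathfinish ?A = pathstart ?seg" "pathstart ?A = pathfinish ?seg"
      by (simp_all only: half_circle_endpoints pathstart_linepath pathfinish_linepath)
    have A_sub: "path_image ?A \<subseteq> {z. Re z \<ge> 0}"
      using path_image_right_half_circle[OF R] by auto
    have A_int: "?P contour_integrable_on ?A"
      by (intro contour_integrable_continuous_part_circlepath Pc) (use A_sub U in blast)
    \<comment> \<open>The closed contour lies in the closed right half plane, which is convex.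
      Differentiability is demanded only in its interior, so the segment may run along the
      boundary.\<close>
    have "(?P has_contour_integral 0) (?A +++ ?seg)"
    proof (rule Cauchy_theorem_convex)
      show "continuous_on {z. Re z \<ge> 0} ?P" by (intro Pc U)
      show "convex {z. Re z \<ge> 0}" by (rule convex_halfspace_Re_ge)
      show "?P field_differentiable at z" if "z \<in> interior {z. Re z \<ge> 0} - {}" for z
        using that interior_subset U holomorphic_on_imp_differentiable_at[OF P U(1)] by blast
      show "valid_path (?A +++ ?seg)" by (intro valid_path_join join) auto
      show "path_image (?A +++ ?seg) \<subseteq> {z. Re z \<ge> 0}"
        using path_image_join_subset[of ?A ?seg] A_sub seg by fastforce
      show "pathfinish (?A +++ ?seg) = pathstart (?A +++ ?seg)"
        unfolding pathfinish_join pathstart_join by (simp only: join)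
    qed auto
    moreover have "(?P has_contour_integral (contour_integral ?A ?P + - contour_integral ?seg ?D / of_real L)) (?A +++ ?seg)"
      by (intro has_contour_integral_join seg_int has_contour_integral_integral[OF A_int]) auto
    ultimately have "contour_integral ?A ?P + - contour_integral ?seg ?D / of_real L = 0"
      by (rule has_contour_integral_unique [symmetric])
    hence "contour_integral ?A ?P = contour_integral ?seg ?D / of_real L"
      by simp
    hence "norm (contour_integral ?A ?P) = norm (contour_integral ?seg ?D) / L"
      using L by (simp add: norm_divide)
    also have "\<dots> \<le> 2 * R * C0 / L"
      using seg_bound L by (intro divide_right_mono) auto
    finally show ?thesis .
  qed

  show ?thesis
  \<comment> \<open>After division by 2 pi, the first summand comes from the segment integral and
    the second from the constant f 0 on the left arc.\<close>
  proof (rule that[of "R * C0 / pi + norm (f 0) / R"])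
    fix S B L
    assume L: "L > (0::real)" and B: "B \<ge> 0" and S: "S holomorphic_on UNIV"
      and right: "\<And>z. norm z = R \<Longrightarrow> Re z > 0 \<Longrightarrow> norm (S z - f z) \<le> B * exp (- (L * Re z)) / Re z"
      and left: "\<And>z. norm z = R \<Longrightarrow> Re z < 0 \<Longrightarrow> norm (S z) \<le> B * exp (- (L * Re z)) / \<bar>Re z\<bar>"
    let ?E = "\<lambda>z. exp (of_real L * z) :: complex"
    define k where "k = (\<lambda>z. K z * ?E z)"
    have k_holo: "k holomorphic_on UNIV"
      unfolding k_def K_def using R by (intro holomorphic_intros) auto
    have k_norm: "norm (k z / z) = exp (L * Re z) * (2 * \<bar>Re z\<bar> / R\<^sup>2)" if "norm z = R" for z
    proof -
      have "norm (k z / z) = norm (?E z) * norm ((1 + z\<^sup>2 / of_real R ^ 2) / z)"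
        by (simp add: k_def K_def norm_mult norm_divide)
      thus ?thesis using circle_kernel[OF that R] by (simp add: norm_exp_eq_Re)
    qed
    have A_sub: "path_image ?A \<subseteq> U - {0}"
      using path_image_right_half_circle[OF R] U R by fastforce
    have A'_nz: "0 \<notin> path_image ?A'"
      using path_image_left_half_circle(1)[OF R, of 0] R by auto
    have cont: "continuous_on (path_image ?A) f" "continuous_on (path_image ?A) S" "continuous_on (path_image ?A) k"
        "continuous_on (path_image ?A') S" "continuous_on (path_image ?A') k"
      using A_sub by (auto intro!: holomorphic_on_imp_continuous_on intro: holomorphic_on_subset[OF f]
          holomorphic_on_subset[OF S] holomorphic_on_subset[OF k_holo])

    have I1: "(\<lambda>z. (S z - f z) * k z / z) contour_integrable_on ?A"
      by (intro contour_integrable_continuous_part_circlepath continuous_on_divide continuous_on_mult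
            continuous_on_diff cont continuous_on_id) (use A_sub in auto)
    have I2: "(\<lambda>z. (f z - f 0) * k z / z) contour_integrable_on ?A"
      by (intro contour_integrable_continuous_part_circlepath continuous_on_divide continuous_on_mult
            continuous_on_diff cont continuous_on_id continuous_on_const) (use A_sub in auto)
    have I3: "(\<lambda>z. (S z - f 0) * k z / z) contour_integrable_on ?A'"
      by (intro contour_integrable_continuous_part_circlepath continuous_on_divide continuous_on_mult
            continuous_on_diff cont continuous_on_id continuous_on_const) (use A'_nz in auto)

    \<comment> \<open>Inserting \<open>k\<close> costs nothing since it equals 1 at 0. On the right
      arc S - f 0 splits into S - f and f - f 0; on the left arc, where f need not be defined, it
      stays whole.\<close>
    have "2 * pi * \<i> * (S 0 - f 0) = 2 * pi * \<i> * ((S 0 - f 0) * k 0)"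
      by (simp add: k_def K_def)
    also have "\<dots> = contour_integral ?A (\<lambda>z. (S z - f 0) * k z / z) + contour_integral ?A' (\<lambda>z. (S z - f 0) * k z / z)"
      by (rule Cauchy_formula_two_half_circles [symmetric, OF _ R]) (intro holomorphic_intros S k_holo)
    also have "contour_integral ?A (\<lambda>z. (S z - f 0) * k z / z) =
       contour_integral ?A (\<lambda>z. (S z - f z) * k z / z + (f z - f 0) * k z / z)"
      by (simp add: add_divide_distrib [symmetric] distrib_right [symmetric])
    also have "\<dots> = contour_integral ?A (\<lambda>z. (S z - f z) * k z / z) + contour_integral ?A (\<lambda>z. (f z - f 0) * k z / z)"
      by (rule contour_integral_add[OF I1 I2])
    also have "contour_integral ?A (\<lambda>z. (f z - f 0) * k z / z) = contour_integral ?A (\<lambda>z. G z * ?E z)"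
      by (rule contour_integral_eq) (use A_sub in \<open>auto simp: G_def F_def k_def\<close>)
    finally have eq: "2 * pi * \<i> * (S 0 - f 0) = contour_integral ?A (\<lambda>z. (S z - f z) * k z / z) +
       contour_integral ?A (\<lambda>z. G z * ?E z) + contour_integral ?A' (\<lambda>z. (S z - f 0) * k z / z)" .

    \<comment> \<open>The hypotheses on \<open>S\<close> say nothing where Re z = 0; these two
      points of the circle are discarded as a finite set.\<close>
    have fin: "finite {\<i> * of_real R, - \<i> * of_real R}" by simp
    have "norm (contour_integral ?A (\<lambda>z. (S z - f z) * k z / z)) \<le> 2 * B / R\<^sup>2 * R * (pi/2 - - pi/2)"
    proof (rule contour_integral_bound_part_circlepath_strong[OF I1 fin])
      fix z assume z: "z \<in> path_image ?A - {\<i> * of_real R, - \<i> * of_real R}"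
      have nz: "norm z = R" and re: "Re z > 0"
        using path_image_right_half_circle[OF R, of z] circle_imaginary_points[of z R] z R by force+
      have "norm ((S z - f z) * k z / z) = norm (S z - f z) * norm (k z / z)"
        by (simp add: norm_mult norm_divide)
      also have "\<dots> \<le> B * exp (- (L * Re z)) / Re z * (exp (L * Re z) * (2 * \<bar>Re z\<bar> / R\<^sup>2))"
        unfolding k_norm[OF nz] by (intro mult_right_mono right nz re) auto
      also have "\<dots> = 2 * B / R\<^sup>2"
        using re R by (simp add: exp_minus field_simps)
      finally show "norm ((S z - f z) * k z / z) \<le> 2 * B / R\<^sup>2" .
    qed (use R B in auto)
    hence b1: "norm (contour_integral ?A (\<lambda>z. (S z - f z) * k z / z)) \<le> 2 * pi * B / R"
      using R by (simp add: power2_eq_square field_simps)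

    have "norm (contour_integral ?A' (\<lambda>z. (S z - f 0) * k z / z)) \<le> (2 * B / R\<^sup>2 + 2 * norm (f 0) / (L * R\<^sup>2)) * R * (3*pi/2 - pi/2)"
    proof (rule contour_integral_bound_part_circlepath_strong[OF I3 fin])
      fix z assume z: "z \<in> path_image ?A' - {\<i> * of_real R, - \<i> * of_real R}"
      have nz: "norm z = R" and re: "Re z < 0"
        using path_image_left_half_circle[OF R, of z] circle_imaginary_points[of z R] z R by force+
      have "norm ((S z - f 0) * k z / z) = norm (S z - f 0) * norm (k z / z)"
        by (simp add: norm_mult norm_divide)
      also have "\<dots> \<le> (B * exp (- (L * Re z)) / \<bar>Re z\<bar> + norm (f 0)) * (exp (L * Re z) * (2 * \<bar>Re z\<bar> / R\<^sup>2))"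
        unfolding k_norm[OF nz] using norm_triangle_ineq4[of "S z" "f 0"] left[OF nz re]
        by (intro mult_right_mono) auto
      also have "\<dots> = 2 * B / R\<^sup>2 + 2 * norm (f 0) / R\<^sup>2 * (\<bar>Re z\<bar> * exp (L * Re z))"
        using re R by (simp add: exp_minus field_simps)
      \<comment> \<open>The constant f 0 brings no factor 1 / |Re z|; instead t exp(-L t) <= 1 / L
        with t = |Re z| makes its share small.\<close>
      also have "\<dots> \<le> 2 * B / R\<^sup>2 + 2 * norm (f 0) / R\<^sup>2 * (1 / L)"
      proof (intro add_left_mono mult_left_mono)
        have "L * \<bar>Re z\<bar> \<le> exp (L * \<bar>Re z\<bar>)"
          using exp_ge_add_one_self[of "L * \<bar>Re z\<bar>"] by linarith
        thus "\<bar>Re z\<bar> * exp (L * Re z) \<le> 1 / L" using L re by (simp add: exp_minus field_simps)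
      qed auto
      finally show "norm ((S z - f 0) * k z / z) \<le> 2 * B / R\<^sup>2 + 2 * norm (f 0) / (L * R\<^sup>2)"
        by (simp add: mult.commute)
    qed (use R B L in auto)
    also have "\<dots> = 2 * pi * B / R + 2 * pi * norm (f 0) / (L * R)"
      using R L by (simp add: power2_eq_square field_simps)
    finally have b3: "norm (contour_integral ?A' (\<lambda>z. (S z - f 0) * k z / z)) \<le> 2 * pi * B / R + 2 * pi * norm (f 0) / (L * R)" .

    have "2 * pi * norm (S 0 - f 0) = norm (2 * pi * \<i> * (S 0 - f 0))"
      by (simp add: norm_mult)
    also have "\<dots> \<le> 2 * pi * B / R + 2 * R * C0 / L + (2 * pi * B / R + 2 * pi * norm (f 0) / (L * R))"
      unfolding eq by (intro norm_triangle_le add_mono b1 b3 G_bound L)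
    also have "\<dots> = 2 * pi * (2 * B / R + (R * C0 / pi + norm (f 0) / R) / L)"
      using R L by (simp add: field_simps)
    finally show "norm (S 0 - f 0) \<le> 2 * B / R + (R * C0 / pi + norm (f 0) / R) / L"
      by simp
  qed
qed

text \<open>The bound on \<open>b\<close> controls the N-th tail for Re z > 0 and the N-th partial
  sum for Re z < 0 by the same expression B exp(-L Re z) / |Re z| with L = ln (N + 1). The contour
  estimate then leaves 2 B / R + C / L: a large R makes the first term small, and for this R a large
  N the second.\<close>

theorem newman_tauberian:
  fixes b :: "nat \<Rightarrow> complex"
  assumes U: "open U" "{z. Re z \<ge> 0} \<subseteq> U" and f: "f holomorphic_on U"
  assumes b: "\<And>n. norm (b n) \<le> B * real n"
  assumes sums: "\<And>z. Re z > 0 \<Longrightarrow> (\<lambda>n. b (Suc n) * newman_weight (Suc n) z) sums f z"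
  shows "(\<lambda>n. b (Suc n) * newman_weight (Suc n) 0) sums f 0"
proof -
  define S where "S = (\<lambda>N z. \<Sum>n<N. b (Suc n) * newman_weight (Suc n) z)"
  have "B \<ge> 0" using order_trans[OF norm_ge_zero b[of 1]] by simp
  have S_holo: "S N holomorphic_on UNIV" for N
    unfolding S_def by (intro holomorphic_intros newman_weight_holomorphic) auto
  \<comment> \<open>For \<sigma> > 0 this is B times the integral of x^(-\<sigma>-1) from n + 1 to
    infinity. Its successive differences bound the terms for either sign of \<sigma>.\<close>
  define h where "h = (\<lambda>\<sigma> n. B * (real (Suc n) powr (- \<sigma>) / \<sigma>))"
  have term_bound: "norm (b (Suc n) * newman_weight (Suc n) z) \<le> h (Re z) n - h (Re z) (Suc n)"
    if "Re z \<noteq> 0" for n z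
  proof -
    have "norm (b (Suc n) * newman_weight (Suc n) z) \<le> B * real (Suc n) * norm (newman_weight (Suc n) z)"
      unfolding norm_mult by (intro mult_right_mono b) auto
    also have "\<dots> \<le> B * ((real (Suc n) powr (- Re z) - (real (Suc n) + 1) powr (- Re z)) / Re z)"
      using norm_newman_weight_le[of "Suc n" z] that \<open>B \<ge> 0\<close> unfolding mult.assoc
      by (intro mult_left_mono) auto
    finally show ?thesis by (simp add: h_def algebra_simps diff_divide_distrib)
  qed
  have h_exp: "h \<sigma> N = B * exp (- (ln (Suc N) * \<sigma>)) / \<sigma>" for \<sigma> N
    by (simp add: h_def powr_def mult.commute)
  have right: "norm (S N z - f z) \<le> B * exp (- (ln (Suc N) * Re z)) / Re z" if z: "Re z > 0" for N z
  proof -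
    have "(\<lambda>n. h (Re z) (n + N)) \<longlonglongrightarrow> 0"
      unfolding h_def using z by real_asymp
    hence t: "(\<lambda>n. h (Re z) (n + N) - h (Re z) (Suc n + N)) sums (h (Re z) (0 + N) - 0)"
      by (rule telescope_sums')
    have *: "(\<lambda>n. b (Suc (n + N)) * newman_weight (Suc (n + N)) z) sums (f z - S N z)"
      unfolding S_def using sums_split_initial_segment[OF sums[OF z]] .
    have "norm (f z - S N z) \<le> h (Re z) N"
      using norm_suminf_le[of "\<lambda>n. b (Suc (n + N)) * newman_weight (Suc (n + N)) z" 
              "\<lambda>n. h (Re z) (n + N) - h (Re z) (Suc n + N)"] term_bound[of z] z sums_unique[OF *] sums_unique[OF t]
        sums_summable[OF t] by auto
    thus ?thesis by (simp only: h_exp norm_minus_commute)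
  qed
  have left: "norm (S N z) \<le> B * exp (- (ln (Suc N) * Re z)) / \<bar>Re z\<bar>" if z: "Re z < 0" for N z
  proof -
    have "norm (S N z) \<le> (\<Sum>n<N. h (Re z) n - h (Re z) (Suc n))"
      unfolding S_def using z by (intro sum_norm_le term_bound) auto
    also have "\<dots> = h (Re z) 0 - h (Re z) N"
      by (rule sum_lessThan_telescope')
    also have "\<dots> \<le> - h (Re z) N"
      using z \<open>B \<ge> 0\<close> by (simp add: h_def mult_nonneg_nonpos divide_nonneg_neg)
    finally show ?thesis using z by (simp add: h_exp)
  qed
  have "(\<lambda>N. S N 0) \<longlonglongrightarrow> f 0"
  proof (rule tendstoI)
    fix e :: real assume e: "e > 0"
    \<comment> \<open>Chosen so that 2 B / R <= e / 2; the summand 1 keeps R positive when B =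
      0.\<close>
    define R where "R = 4 * (B + 1) / e"
    have R: "R > 0" using e \<open>B \<ge> 0\<close> by (simp add: R_def)
    obtain C where C: "\<And>S B L. L > 0 \<Longrightarrow> B \<ge> 0 \<Longrightarrow> S holomorphic_on UNIV \<Longrightarrow>
      (\<And>z. norm z = R \<Longrightarrow> Re z > 0 \<Longrightarrow> norm (S z - f z) \<le> B * exp (- (L * Re z)) / Re z) \<Longrightarrow>
      (\<And>z. norm z = R \<Longrightarrow> Re z < 0 \<Longrightarrow> norm (S z) \<le> B * exp (- (L * Re z)) / \<bar>Re z\<bar>) \<Longrightarrow>
      norm (S 0 - f 0) \<le> 2 * B / R + C / L"
      using newman_contour_estimate[OF U f R] by blast
    have "(\<lambda>N. C / ln (real (Suc N))) \<longlonglongrightarrow> 0" by real_asymp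
    hence "\<forall>\<^sub>F N in sequentially. C / ln (real (Suc N)) < e / 2"
      using e by (intro order_tendstoD) auto
    thus "\<forall>\<^sub>F N in sequentially. dist (S N 0) (f 0) < e"
      using eventually_gt_at_top[of 0]
    proof eventually_elim
      case (elim N)
      have "norm (S N 0 - f 0) \<le> 2 * B / R + C / ln (real (Suc N))"
        by (rule C) (use elim \<open>B \<ge> 0\<close> S_holo left right in auto)
      moreover have "2 * B / R \<le> e / 2"
        using e \<open>B \<ge> 0\<close> by (simp add: R_def field_simps)
      ultimately show ?case using elim(1) unfolding dist_norm by linarith
    qed
  qed
  thus ?thesis by (simp add: sums_def S_def)
qed

section \<open>The Chebyshev functions\<close>

definition cheb_psi :: "nat \<Rightarrow> real" where
  "cheb_psi n = (\<Sum>k=1..n. mangoldt k)"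

definition cheb_theta :: "nat \<Rightarrow> real" where
  "cheb_theta n = (\<Sum>p | prime p \<and> p \<le> n. ln (real p))"

lemma cheb_psi_Suc: "cheb_psi (Suc n) = cheb_psi n + mangoldt (Suc n)"
  by (simp add: cheb_psi_def)

lemma cheb_psi_mono: "m \<le> n \<Longrightarrow> cheb_psi m \<le> cheb_psi n"
  unfolding cheb_psi_def by (intro sum_mono2) (auto simp: mangoldt_nonneg)

lemma cheb_psi_nonneg: "0 \<le> cheb_psi n"
  unfolding cheb_psi_def by (intro sum_nonneg) (auto simp: mangoldt_nonneg)

text \<open>Passing from n to n + 1 raises n div d by one exactly for the divisors d of n + 1, and
  the von Mangoldt function summed over these is ln (n + 1).\<close>

lemma ln_fact_eq_sum_mangoldt:
  "ln (fact n) = (\<Sum>d=1..n. mangoldt d * real (n div d))"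
proof (induction n)
  case (Suc n)
  have "ln (fact (Suc n)) = ln (real (Suc n)) + ln (fact n :: real)"
    by (simp add: ln_mult del: of_nat_Suc)
  also have "ln (real (Suc n)) = (\<Sum>d | d dvd Suc n. mangoldt d)"
    by (subst mangoldt_sum) simp_all
  also have "\<dots> = (\<Sum>d=1..Suc n. if d dvd Suc n then mangoldt d else 0)"
    by (intro sum.mono_neutral_cong_left) (auto dest: dvd_imp_le simp: Suc_le_eq intro!: Nat.gr0I)
  also have "ln (fact n :: real) = (\<Sum>d=1..Suc n. mangoldt d * real (n div d))"
    by (simp add: Suc.IH)
  also have "(\<Sum>d=1..Suc n. if d dvd Suc n then mangoldt d else 0) + \<dots>
      = (\<Sum>d=1..Suc n. mangoldt d * real (Suc n div d))"
    unfolding sum.distrib [symmetric]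
    by (intro sum.cong) (auto simp: div_Suc mod_eq_0_iff_dvd algebra_simps)
  finally show ?case .
qed simp

text \<open>Chebyshev's argument: floor(2n/d) - 2 floor(n/d) is never negative and equals 1 for n <
  d <= 2n. Weighted by the von Mangoldt function it sums to the logarithm of the central binomial
  coefficient, which is at most 2n ln 2.\<close>

lemma cheb_psi_double: "cheb_psi (2 * n) - cheb_psi n \<le> 2 * real n * ln 2"
proof -
  have "cheb_psi (2 * n) - cheb_psi n = (\<Sum>d\<in>{1..2*n} - {1..n}. mangoldt d)"
    unfolding cheb_psi_def by (subst sum_diff) auto
  also have "\<dots> = (\<Sum>d=1..2*n. if n < d then mangoldt d else 0)"
    by (intro sum.mono_neutral_cong_left) auto
  also have "\<dots> \<le> (\<Sum>d=1..2*n. mangoldt d * (real (2 * n div d) - 2 * real (n div d)))"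
  proof (intro sum_mono)
    fix d assume d: "d \<in> {1..2*n}"
    have "2 * (n div d) \<le> 2 * n div d"
      using div_times_less_eq_dividend[of n d] d by (subst less_eq_div_iff_mult_less_eq) auto
    hence *: "0 \<le> real (2 * n div d) - 2 * real (n div d)"
      by linarith
    show "(if n < d then mangoldt d else 0)
        \<le> mangoldt d * (real (2 * n div d) - 2 * real (n div d))"
    proof (cases "n < d")
      case True
      hence "n div d = 0" "2 * n div d = 1"
        using d by (auto intro!: div_nat_eqI)
      thus ?thesis by (simp add: mangoldt_nonneg)
    qed (use * in \<open>simp add: mangoldt_nonneg\<close>)
  qed
  also have "\<dots> = ln (fact (2 * n)) - 2 * (\<Sum>d=1..2*n. mangoldt d * real (n div d))"
    by (simp add: ln_fact_eq_sum_mangoldt sum_distrib_left sum_subtractf algebra_simps)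
  also have "(\<Sum>d=1..2*n. mangoldt d * real (n div d)) = (\<Sum>d=1..n. mangoldt d * real (n div d))"
    by (intro sum.mono_neutral_cong_right) auto
  also have "\<dots> = ln (fact n)"
    by (simp add: ln_fact_eq_sum_mangoldt)
  also have "ln (fact (2 * n) :: real) - 2 * ln (fact n) = ln (real (2 * n choose n))"
  proof -
    have "(fact (2 * n) :: real) = fact n * fact n * real (2 * n choose n)"
      using arg_cong[OF binomial_fact_lemma[of n "2 * n"], of real] by (simp add: mult_2)
    thus ?thesis by (simp add: ln_mult)
  qed
  also have "\<dots> \<le> ln (real (2 ^ (2 * n)))"
  proof -
    have "2 * n choose n \<le> 2 ^ (2 * n)"
      using binomial_le_pow2 by blast
    thus ?thesis
      by (subst ln_le_cancel_iff) (auto simp del: of_nat_power)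
  qed
  also have "\<dots> = 2 * real n * ln 2"
    by (simp add: ln_realpow)
  finally show ?thesis .
qed

lemma ln_two_le_one: "ln (2 :: real) \<le> 1"
  using ln_le_minus_one[of 2] by simp

text \<open>Halving n gives \<psi>(2m) <= 4m + 2m = 6m. For odd n = 2m + 1 the extra term is at most
  2m, which the constant 4 still accommodates.\<close>

lemma cheb_psi_le: "cheb_psi n \<le> 4 * real n"
proof (induction n rule: less_induct)
  case (less n)
  show ?case
  proof (cases "n = 0")
    case True
    thus ?thesis by (simp add: cheb_psi_def)
  next
    case False
    define m where "m = n div 2"
    have m: "m < n" "n = 2 * m \<or> n = Suc (2 * m)" 
      using False by (auto simp: m_def)
    have *: "cheb_psi (2 * m) \<le> 6 * real m"
      using cheb_psi_double[of m] less.IH[OF m(1)] mult_left_mono[OF ln_two_le_one, of "2 * real m"]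
      by simp
    have "(mangoldt (Suc (2 * m)) :: real) \<le> ln (real (Suc (2 * m)))"
      by (intro mangoldt_le) simp
    also have "\<dots> \<le> 2 * real m"
      using ln_le_minus_one[of "real (Suc (2 * m))"] by simp
    finally show ?thesis
      using * m(2) by (auto simp: cheb_psi_Suc)
  qed
qed

text \<open>Proper prime powers up to \<open>n\<close> have base at most \<open>sqrt n\<close> and exponent at most \<open>log 2 n\<close>.\<close>
lemma cheb_psi_minus_theta_le:
  assumes n: "n \<ge> 1"
  shows "cheb_psi n - cheb_theta n \<le> sqrt n * (log 2 n + 1) * ln n"
proof -
  define S where "S = {k\<in>{1..n}. primepow k \<and> \<not>prime k}"
  have "cheb_psi n = (\<Sum>k\<in>{p. prime p \<and> p \<le> n} \<union> S. mangoldt k)"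
    unfolding cheb_psi_def S_def
    by (intro sum.mono_neutral_right) (auto simp: mangoldt_def dest: prime_gt_0_nat)
  also have "\<dots> = (\<Sum>p | prime p \<and> p \<le> n. mangoldt p) + (\<Sum>k\<in>S. mangoldt k)"
    by (intro sum.union_disjoint) (auto simp: S_def)
  also have "(\<Sum>p | prime p \<and> p \<le> n. mangoldt p) = cheb_theta n"
    unfolding cheb_theta_def by (intro sum.cong) auto
  finally have "cheb_psi n - cheb_theta n = (\<Sum>k\<in>S. mangoldt k)" by simp
  also have "\<dots> \<le> (\<Sum>k\<in>S. ln n)"
  proof (intro sum_mono)
    fix k assume "k \<in> S"
    hence k: "0 < k" "k \<le> n" by (auto simp: S_def)
    have "(mangoldt k :: real) \<le> ln (real k)"
      by (intro mangoldt_le k)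
    also have "\<dots> \<le> ln n" using k by simp
    finally show "mangoldt k \<le> ln n" .
  qed
  also have "\<dots> = real (card S) * ln n" by simp
  also have "\<dots> \<le> (sqrt n * (log 2 n + 1)) * ln n"
  proof (intro mult_right_mono)
    let ?P = "{1..nat \<lfloor>sqrt n\<rfloor>}" and ?J = "{..nat \<lfloor>log 2 n\<rfloor>}"
    have "S \<subseteq> (\<lambda>(p,j). p ^ j) ` (?P \<times> ?J)"
    proof
      fix k assume k: "k \<in> S"
      then obtain p j where pj: "prime p" "j > 0" "k = p ^ j" 
        by (auto simp: S_def primepow_def)
      have p2: "p \<ge> 2" using pj(1) by (rule prime_ge_2_nat)
      have "j \<noteq> 1" using k pj by (auto simp: S_def)
      hence "j \<ge> 2" using pj by linarith
      hence "p ^ 2 \<le> p ^ j" using p2 by (intro power_increasing) auto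
      also have "\<dots> \<le> n" using k pj by (auto simp: S_def)
      finally have "real (p ^ 2) \<le> real n" by (simp only: of_nat_le_iff)
      hence 1: "real p \<le> sqrt n" by (intro real_le_rsqrt) simp
      have "2 ^ j \<le> p ^ j" using p2 by (intro power_mono) auto
      also have "\<dots> \<le> n" using k pj by (auto simp: S_def)
      finally have "real (2 ^ j) \<le> real n" by (simp only: of_nat_le_iff)
      hence "real j \<le> log 2 n" using n by (subst le_log_iff) (auto simp: powr_realpow)
      with 1 pj p2 show "k \<in> (\<lambda>(p,j). p ^ j) ` (?P \<times> ?J)"
        by (auto intro!: image_eqI[of _ _ "(p,j)"] simp: le_nat_floor)
    qed
    hence "card S \<le> card (?P \<times> ?J)"
      by (rule surj_card_le[rotated]) auto
    also have "\<dots> = nat \<lfloor>sqrt n\<rfloor> * (nat \<lfloor>log 2 n\<rfloor> + 1)" by simp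
    finally have "real (card S) \<le> real (nat \<lfloor>sqrt n\<rfloor> * (nat \<lfloor>log 2 n\<rfloor> + 1))"
      by (simp only: of_nat_le_iff)
    also have "\<dots> = real (nat \<lfloor>sqrt n\<rfloor>) * (real (nat \<lfloor>log 2 n\<rfloor>) + 1)"
      by (simp only: of_nat_mult of_nat_add of_nat_1)
    also have "\<dots> \<le> sqrt n * (log 2 n + 1)"
      using n by (intro mult_mono add_right_mono of_nat_floor add_nonneg_nonneg) auto
    finally show "real (card S) \<le> sqrt n * (log 2 n + 1)" .
  qed (use n in auto)
  finally show ?thesis .
qed

lemma cheb_theta_le_psi: "cheb_theta n \<le> cheb_psi n"
proof -
  have "cheb_theta n = (\<Sum>p | prime p \<and> p \<le> n. mangoldt p)"
    unfolding cheb_theta_def by (intro sum.cong) auto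
  also have "\<dots> \<le> cheb_psi n" unfolding cheb_psi_def 
    by (intro sum_mono2) (auto simp: mangoldt_nonneg Suc_le_eq dest: prime_gt_0_nat)
  finally show ?thesis .
qed

lemma cheb_theta_asymptotics:
  assumes "(\<lambda>n. cheb_psi n / n) \<longlonglongrightarrow> 1"
  shows "(\<lambda>n. cheb_theta n / n) \<longlonglongrightarrow> 1"
proof (rule tendsto_sandwich)
  have "(\<lambda>n::nat. sqrt n * (log 2 n + 1) * ln n / n) \<longlonglongrightarrow> 0"
    by real_asymp
  from tendsto_diff[OF assms this]
  show "(\<lambda>n. cheb_psi n / n - sqrt n * (log 2 n + 1) * ln n / n) \<longlonglongrightarrow> 1" by simp
  show "\<forall>\<^sub>F n in sequentially. cheb_psi n / n - sqrt n * (log 2 n + 1) * ln n / n \<le> cheb_theta n / n"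
    using eventually_ge_at_top[of 1]
  proof eventually_elim
    case (elim n)
    show ?case using cheb_psi_minus_theta_le[OF elim] elim
      by (simp add: diff_divide_distrib [symmetric] divide_right_mono)
  qed
  show "\<forall>\<^sub>F n in sequentially. cheb_theta n / n \<le> cheb_psi n / n"
    by (intro always_eventually allI divide_right_mono cheb_theta_le_psi) auto
qed (fact assms)

section \<open>The zeta function on the line \<open>Re s = 1\<close>\<close>

text \<open>The condition Re s >= -1 makes the modulus of the derivative, |s| t^(-Re s - 1), largest
  at the left end point.\<close>

lemma npow_diff_bound:
  assumes "0 < a" "a \<le> x" "Re s \<ge> -1"
  shows "norm (npow x s - npow a s) \<le> norm s * a powr (- Re s - 1) * (x - a)"
proof -
  have "((\<lambda>t. - s * npow t (s + 1)) has_integral (npow x s - npow a s)) {a..x}"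
    by (intro fundamental_theorem_of_calculus npow_derivative_base) (use assms in auto)
  hence "norm (npow x s - npow a s) \<le> norm s * a powr (- Re s - 1) * measure lborel {a..x}"
  proof (rule has_integral_bound_real[rotated 2])
    show "norm (- s * npow t (s + 1)) \<le> norm s * a powr (- Re s - 1)" if "t \<in> {a..x} - {}" for t
    proof -
      have "t powr (- Re s - 1) \<le> a powr (- Re s - 1)"
        using that assms by (intro powr_mono2') auto
      thus ?thesis using that assms by (auto simp: norm_mult norm_npow intro!: mult_left_mono)
    qed
  qed auto
  thus ?thesis using assms by simp
qed

text \<open>Subtracting the integral of x^(-s) over [n, n + 1] gains a factor |s| / n over the size
  of n^(-s). This moves the region of convergence from Re s > 1 to Re s > 0.\<close>

lemma npow_minus_weight_bound:
  assumes "n \<ge> 1" "Re s \<ge> -1"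
  shows "norm (npow n s - newman_weight n (s - 2)) \<le> norm s * real n powr (- Re s - 1)"
proof -
  have int: "(\<lambda>x. npow x s) integrable_on {real n..real n + 1}"
    using assms by (auto intro!: integrable_continuous_real continuous_on_subset[OF continuous_npow_base])
  have "((\<lambda>x. npow n s) has_integral npow n s) {real n..real n + 1}"
    using has_integral_const_real[of "npow n s" "real n" "real n + 1"] by simp
  from has_integral_diff[OF this integrable_integral[OF int]]
  have "((\<lambda>x. npow n s - npow x s) has_integral (npow n s - newman_weight n (s - 2))) {real n..real n + 1}"
    by (simp add: newman_weight_def)
  hence "norm (npow n s - newman_weight n (s - 2)) \<le> norm s * real n powr (- Re s - 1) * measure lborel {real n..real n + 1}"
  proof (rule has_integral_bound_real[rotated 2])
    fix x assume "x \<in> {real n..real n + 1} - {}"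
    hence x: "real n \<le> x" "x \<le> real n + 1" by auto
    have "norm (npow n s - npow x s) \<le> norm s * real n powr (- Re s - 1) * (x - n)"
      using npow_diff_bound[of "real n" x s] assms x by (simp add: norm_minus_commute)
    also have "\<dots> \<le> norm s * real n powr (- Re s - 1) * 1"
      using x by (intro mult_left_mono) auto
    finally show "norm (npow n s - npow x s) \<le> norm s * real n powr (- Re s - 1)" by simp
  qed auto
  thus ?thesis by simp
qed

text \<open>The Weierstrass test with a majorant that is only local, as required on an open half
  plane, together with termwise differentiation.\<close>

lemma holomorphic_series:
  assumes S: "open S" and f: "\<And>n. f n holomorphic_on S"
    and bound: "\<And>x. x \<in> S \<Longrightarrow> \<exists>d h. 0 < d \<and> summable h \<and> (\<forall>n. \<forall>y\<in>ball x d \<inter> S. norm (f n y) \<le> h n)"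
  shows "(\<lambda>s. \<Sum>n. f n s) holomorphic_on S"
    and "\<And>s. s \<in> S \<Longrightarrow> (\<lambda>n. f n s) sums (\<Sum>n. f n s)"
    and "\<And>s. s \<in> S \<Longrightarrow> (\<lambda>n. deriv (f n) s) sums deriv (\<lambda>s. \<Sum>n. f n s) s"
proof -
  have "\<exists>g g'. \<forall>x\<in>S. (\<lambda>n. f n x) sums g x \<and> (\<lambda>n. deriv (f n) x) sums g' x \<and> (g has_field_derivative g' x) (at x)"
  proof (rule series_and_derivative_comparison_local[OF S])
    show "(f n has_field_derivative deriv (f n) x) (at x)" if "x \<in> S" for n x
      by (rule holomorphic_derivI[OF f S that])
    show "\<exists>d h. 0 < d \<and> summable h \<and> (\<forall>\<^sub>F n in sequentially. \<forall>y\<in>ball x d \<inter> S. norm (f n y) \<le> h n)" if "x \<in> S" for x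
    proof -
      obtain d h where "0 < d" "summable h" "\<forall>n. \<forall>y\<in>ball x d \<inter> S. norm (f n y) \<le> h n"
        using bound[OF \<open>x \<in> S\<close>] by blast
      thus ?thesis by (intro exI[of _ d] exI[of _ h] conjI always_eventually) auto
    qed
  qed
  then obtain g g' where g: "\<And>x. x \<in> S \<Longrightarrow> (\<lambda>n. f n x) sums g x" "\<And>x. x \<in> S \<Longrightarrow> (\<lambda>n. deriv (f n) x) sums g' x"
     "\<And>x. x \<in> S \<Longrightarrow> (g has_field_derivative g' x) (at x)" by blast
  have eq: "(\<Sum>n. f n x) = g x" if "x \<in> S" for x using g(1)[OF that] by (simp add: sums_iff)
  have der: "((\<lambda>s. \<Sum>n. f n s) has_field_derivative g' x) (at x)" if "x \<in> S" for x
    by (rule has_field_derivative_transform_within_open[OF g(3)[OF that] S that]) (simp add: eq)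
  show "(\<lambda>s. \<Sum>n. f n s) holomorphic_on S"
    using der by (auto simp: holomorphic_on_open[OF S])
  show "(\<lambda>n. f n s) sums (\<Sum>n. f n s)" if "s \<in> S" for s using g(1)[OF that] eq[OF that] by simp
  show "(\<lambda>n. deriv (f n) s) sums deriv (\<lambda>s. \<Sum>n. f n s) s" if "s \<in> S" for s
    using g(2)[OF that] DERIV_imp_deriv[OF der[OF that]] by simp
qed

lemma summable_Suc_powr: "a < -1 \<Longrightarrow> summable (\<lambda>n. real (Suc n) powr a)"
  using summable_real_powr_iff[of a] summable_Suc_iff[of "\<lambda>n. real n powr a"] by simp

text \<open>For \<open>Re s > 0\<close>, \<open>zeta_reg s\<close> is \<open>\<zeta>(s) - 1/(s - 1)\<close> and \<open>zeta_num s\<close> is \<open>(s - 1) \<zeta>(s)\<close>.\<close>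

definition zeta_reg :: "complex \<Rightarrow> complex" where
  "zeta_reg s = (\<Sum>n. npow (Suc n) s - newman_weight (Suc n) (s - 2))"

definition zeta_num :: "complex \<Rightarrow> complex" where
  "zeta_num s = 1 + (s - 1) * zeta_reg s"

lemma zeta_reg_aux:
  "zeta_reg holomorphic_on {s. Re s > 0}"
  "Re s > 0 \<Longrightarrow> (\<lambda>n. npow (Suc n) s - newman_weight (Suc n) (s - 2)) sums zeta_reg s"
proof -
  have op: "open {s. Re s > 0}" by (rule open_halfspace_Re_gt)
  have holo: "(\<lambda>s. npow (Suc n) s - newman_weight (Suc n) (s - 2)) holomorphic_on {s. Re s > 0}" for n
    by (intro holomorphic_intros npow_holomorphic 
          holomorphic_on_compose_gen[OF _ newman_weight_holomorphic, unfolded o_def]) auto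
  have bound: "\<exists>d h. 0 < d \<and> summable h \<and> (\<forall>n. \<forall>y\<in>ball x d \<inter> {s. Re s > 0}. 
      norm (npow (Suc n) y - newman_weight (Suc n) (y - 2)) \<le> h n)" if "x \<in> {s. Re s > 0}" for x
  proof (intro exI conjI allI ballI)
    \<comment> \<open>On this ball Re y >= Re x / 2, so one convergent series dominates
      throughout.\<close>
    let ?d = "Re x / 2"
    show "0 < ?d" using that by simp
    show "summable (\<lambda>n. (norm x + ?d) * real (Suc n) powr (- ?d - 1))"
      using that by (intro summable_mult summable_Suc_powr) simp
    fix n y assume y: "y \<in> ball x ?d \<inter> {s. Re s > 0}"
    have "norm y \<le> norm x + ?d"
      using y norm_triangle_ineq2[of y x] by (auto simp: dist_norm norm_minus_commute)
    moreover have "Re y \<ge> ?d"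
      using y abs_Re_le_cmod[of "x - y"] by (auto simp: dist_norm)
    hence "real (Suc n) powr (- Re y - 1) \<le> real (Suc n) powr (- ?d - 1)"
      by (intro powr_mono) auto
    moreover have "norm (npow (Suc n) y - newman_weight (Suc n) (y - 2)) \<le> norm y * real (Suc n) powr (- Re y - 1)"
      using y by (intro npow_minus_weight_bound) auto
    ultimately show "norm (npow (Suc n) y - newman_weight (Suc n) (y - 2)) \<le> (norm x + ?d) * real (Suc n) powr (- ?d - 1)"
      using that by (smt (verit, best) mult_mono norm_ge_zero powr_ge_zero mem_Collect_eq)
  qed
  note * = holomorphic_series[OF op holo bound]
  show "zeta_reg holomorphic_on {s. Re s > 0}"
    using *(1) unfolding zeta_reg_def .
  show "(\<lambda>n. npow (Suc n) s - newman_weight (Suc n) (s - 2)) sums zeta_reg s" if "Re s > 0"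
    unfolding zeta_reg_def using that by (intro *(2)) auto
qed

lemma zeta_num_holomorphic: "zeta_num holomorphic_on {s. Re s > 0}"
  unfolding zeta_num_def by (intro holomorphic_intros zeta_reg_aux(1))

lemma npow_null:
  assumes "Re s > 0"
  shows "(\<lambda>n. npow (Suc n) s) \<longlonglongrightarrow> 0"
proof (rule tendsto_norm_zero_cancel)
  have "(\<lambda>n. real (Suc n) powr - Re s) \<longlonglongrightarrow> 0" using assms by real_asymp
  thus "(\<lambda>n. norm (npow (Suc n) s)) \<longlonglongrightarrow> 0" by (simp add: norm_npow)
qed

text \<open>The weights are the pieces of the integral of x^(-s) over x >= 1. Multiplied by s - 1
  they telescope to 1, which restores the pole 1 / (s - 1).\<close>

lemma zeta_sums:
  assumes "Re s > 1"
  shows "(\<lambda>n. npow (Suc n) s) sums (zeta_reg s + 1 / (s - 1))"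
proof -
  have s1: "s \<noteq> 1" using assms by auto
  have "(\<lambda>n. npow (Suc n) (s - 1) - npow (Suc (Suc n)) (s - 1)) sums (npow (Suc 0) (s - 1) - 0)"
    by (intro telescope_sums' npow_null) (use assms in auto)
  also have "(\<lambda>n. npow (Suc n) (s - 1) - npow (Suc (Suc n)) (s - 1)) = 
      (\<lambda>n. (s - 1) * newman_weight (Suc n) (s - 2))"
    using newman_weight_eq[of "Suc n" "s - 2" for n] by (auto simp: algebra_simps)
  finally have "(\<lambda>n. (s - 1) * newman_weight (Suc n) (s - 2) / (s - 1)) sums (1 / (s - 1))"
    by (intro sums_divide) simp
  hence "(\<lambda>n. newman_weight (Suc n) (s - 2)) sums (1 / (s - 1))" using s1 by simp
  from sums_add[OF zeta_reg_aux(2)[of s] this] show ?thesis using assms by simp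
qed

text \<open>Termwise differentiation of the zeta series; the value on the right is
  -\<zeta>'(s).\<close>

lemma zeta_deriv_sums:
  assumes "Re s > 1"
  shows "(\<lambda>n. of_real (ln (Suc n)) * npow (Suc n) s) sums (1 / (s - 1)\<^sup>2 - deriv zeta_reg s)"
proof -
  let ?S = "{s. Re s > 1}"
  have op: "open ?S" by (rule open_halfspace_Re_gt)
  have holo: "(\<lambda>s. npow (Suc n) s) holomorphic_on ?S" for n by (rule npow_holomorphic)
  have bound: "\<exists>d h. 0 < d \<and> summable h \<and> (\<forall>n. \<forall>y\<in>ball x d \<inter> ?S. norm (npow (Suc n) y) \<le> h n)" if "x \<in> ?S" for x
  proof (intro exI conjI allI ballI)
    let ?d = "(Re x - 1) / 2"
    show "0 < ?d" using that by simp
    show "summable (\<lambda>n. real (Suc n) powr (- 1 - ?d))"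
      using that by (intro summable_Suc_powr) simp
    fix n y assume y: "y \<in> ball x ?d \<inter> ?S"
    have "Re y \<ge> 1 + ?d"
      using y abs_Re_le_cmod[of "x - y"] by (auto simp: dist_norm field_simps)
    hence "real (Suc n) powr (- Re y) \<le> real (Suc n) powr (- 1 - ?d)"
      by (intro powr_mono) auto
    thus "norm (npow (Suc n) y) \<le> real (Suc n) powr (- 1 - ?d)" by (simp add: norm_npow)
  qed
  have s: "s \<in> ?S" using assms by simp
  have "(\<lambda>n. deriv (\<lambda>s. npow (Suc n) s) s) sums deriv (\<lambda>s. \<Sum>n. npow (Suc n) s) s"
    by (rule holomorphic_series(3)[OF op holo bound s])
  also have "deriv (\<lambda>s. \<Sum>n. npow (Suc n) s) s = deriv zeta_reg s - 1 / (s - 1)\<^sup>2"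
  proof (rule DERIV_imp_deriv)
    have "(zeta_reg has_field_derivative deriv zeta_reg s) (at s)"
      by (rule holomorphic_derivI[OF zeta_reg_aux(1)]) (use assms in \<open>auto simp: open_halfspace_Re_gt\<close>)
    hence "((\<lambda>s. zeta_reg s + 1 / (s - 1)) has_field_derivative deriv zeta_reg s - 1 / (s - 1)\<^sup>2) (at s)"
      using assms by (auto intro!: derivative_eq_intros simp: power2_eq_square)
    thus "((\<lambda>s. \<Sum>n. npow (Suc n) s) has_field_derivative deriv zeta_reg s - 1 / (s - 1)\<^sup>2) (at s)"
      by (rule has_field_derivative_transform_within_open[OF _ op s]) (use zeta_sums in \<open>auto simp: sums_iff\<close>)
  qed
  also have "(\<lambda>n. deriv (\<lambda>s. npow (Suc n) s) s) = (\<lambda>n. - (of_real (ln (Suc n)) * npow (Suc n) s))"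
    by (intro ext DERIV_imp_deriv) (use npow_derivative_exponent in auto)
  finally have "(\<lambda>n. - (of_real (ln (Suc n)) * npow (Suc n) s)) sums (deriv zeta_reg s - 1 / (s - 1)\<^sup>2)" .
  from sums_minus[OF this] show ?thesis by simp
qed

lemma summable_ln_npow:
  assumes "Re s > 1"
  shows "summable (\<lambda>n. ln (real (Suc n)) * norm (npow (Suc n) s))"
proof (rule summable_comparison_test_bigo)
  define e where "e = (Re s - 1) / 2"
  have e: "e > 0" "Re s = 1 + 2 * e" using assms by (simp_all add: e_def field_simps)
  show "summable (\<lambda>n. norm (real (Suc n) powr (- 1 - e)))"
    using summable_Suc_powr[of "- 1 - e"] e by simp
  have "(\<lambda>n. ln (real (Suc n)) * real (Suc n) powr (- (1 + 2 * e))) \<in> O(\<lambda>n. real (Suc n) powr (- 1 - e))"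
    using e by real_asymp
  thus "(\<lambda>n. ln (real (Suc n)) * norm (npow (Suc n) s)) \<in> O(\<lambda>n. real (Suc n) powr (- 1 - e))"
    by (simp add: norm_npow e(2))
qed

section \<open>The Dirichlet series of the von Mangoldt function\<close>

text \<open>For Re s > 1 this is -\<zeta>'(s) / \<zeta>(s).\<close>

definition mangoldt_series :: "complex \<Rightarrow> complex" where
  "mangoldt_series s = (\<Sum>n. mangoldt (Suc n) * npow (Suc n) s)"

lemma summable_mangoldt:
  assumes "Re s > 1"
  shows "summable (\<lambda>n. norm (mangoldt (Suc n) * npow (Suc n) s))"
proof (rule summable_comparison_test'[OF summable_ln_npow[OF assms]])
  show "norm (norm (mangoldt (Suc n) * npow (Suc n) s)) \<le> ln (real (Suc n)) * norm (npow (Suc n) s)" 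
    if "n \<ge> 0" for n
    using mangoldt_le[of "Suc n"] by (simp add: norm_mult abs_mult mult_right_mono)
qed

lemma mangoldt_sums:
  "Re s > 1 \<Longrightarrow> (\<lambda>n. mangoldt (Suc n) * npow (Suc n) s) sums mangoldt_series s"
  unfolding mangoldt_series_def by (rule summable_sums[OF summable_norm_cancel[OF summable_mangoldt]])

text \<open>Absolute convergence of both factors gives an unordered double sum, which may then be
  regrouped along n = d m.\<close>

lemma has_sum_product_abs:
  fixes f :: "'a \<Rightarrow> complex" and g :: "'b \<Rightarrow> complex"
  assumes "(\<lambda>x. norm (f x)) summable_on A" "(\<lambda>x. norm (g x)) summable_on B" "(f has_sum a) A" "(g has_sum b) B"
  shows "((\<lambda>(x,y). f x * g y) has_sum (a * b)) (A \<times> B)"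
proof (rule has_sum_SigmaI)
  show "((\<lambda>y. case (x, y) of (x, y) \<Rightarrow> f x * g y) has_sum f x * b) B" for x
    using has_sum_cmult_right[OF assms(4)] by simp
  show "((\<lambda>x. f x * b) has_sum a * b) A" by (rule has_sum_cmult_left[OF assms(3)])
  have "(\<lambda>p. norm (case p of (x,y) \<Rightarrow> f x * g y)) summable_on A \<times> B"
    unfolding Infinite_Sum.abs_summable_on_Sigma_iff
    using assms(1,2) by (auto simp: norm_mult infsum_cmult_right' abs_mult
        intro!: summable_on_cmult_right summable_on_cmult_left)
  thus "(\<lambda>(x,y). f x * g y) summable_on A \<times> B" by (rule abs_summable_summable)
qed

text \<open>Dirichlet convolution: pairs (d, m) are regrouped by their product n, and the von
  Mangoldt function summed over the divisors of n is ln n. The resulting series is that of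
  -\<zeta>'.\<close>

lemma mangoldt_times_zeta:
  assumes s: "Re s > 1"
  shows "mangoldt_series s * (zeta_reg s + 1 / (s - 1)) = 1 / (s - 1)\<^sup>2 - deriv zeta_reg s"
proof -
  have bij: "bij_betw Suc UNIV {1..}"
    by (rule bij_betwI[of _ _ _ "\<lambda>n. n - 1"]) auto
  let ?f = "\<lambda>n. mangoldt n * npow n s" and ?g = "\<lambda>n. npow (real n) s"
  have f: "summable (\<lambda>n. norm (?f (Suc n)))" by (rule summable_mangoldt[OF s])
  have g: "summable (\<lambda>n. norm (?g (Suc n)))"
    using summable_Suc_powr[of "- Re s"] s by (simp add: norm_npow)
  have F: "(?f has_sum mangoldt_series s) {1..}"
    using norm_summable_imp_has_sum[OF f mangoldt_sums[OF s]]
    by (simp only: has_sum_reindex_bij_betw[OF bij, of ?f])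
  have G: "(?g has_sum (zeta_reg s + 1 / (s - 1))) {1..}"
    using norm_summable_imp_has_sum[OF g zeta_sums[OF s]]
    by (simp only: has_sum_reindex_bij_betw[OF bij, of ?g])
  have prod: "((\<lambda>(d,m). ?f d * ?g m) has_sum (mangoldt_series s * (zeta_reg s + 1 / (s - 1)))) ({1..} \<times> {1..})"
  proof (rule has_sum_product_abs[OF _ _ F G])
    show "(\<lambda>n. norm (?f n)) summable_on {1..}" "(\<lambda>n. norm (?g n)) summable_on {1..}"
      by (rule summable_on_iff_abs_summable_on_complex[THEN iffD1], rule has_sum_imp_summable, fact F)
         (rule summable_on_iff_abs_summable_on_complex[THEN iffD1], rule has_sum_imp_summable, fact G)
  qed
  have "((\<lambda>(d,m). ?f d * ?g m) has_sum (mangoldt_series s * (zeta_reg s + 1 / (s - 1)))) ({1..} \<times> {1..})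
     \<longleftrightarrow> ((\<lambda>(n,d). mangoldt d * npow (real n) s) has_sum (mangoldt_series s * (zeta_reg s + 1 / (s - 1))))
       (Sigma {1..} (\<lambda>n. {d. d dvd n}))"
  proof (rule has_sum_reindex_bij_witness[where i = "\<lambda>(n,d). (d, n div d)" and j = "\<lambda>(d,m). (d * m, d)"])
    fix a :: "nat \<times> nat" assume "a \<in> {1..} \<times> {1..}"
    then obtain d m where a: "a = (d, m)" "d > 0" "m > 0" by (auto simp: Suc_le_eq)
    thus "(case case a of (d, m) \<Rightarrow> (d * m, d) of (n, d) \<Rightarrow> mangoldt d * npow n s) = (case a of (d, m) \<Rightarrow> ?f d * ?g m)"
      by (simp add: npow_mult mult.assoc)
  next
    fix b :: "nat \<times> nat" assume "b \<in> Sigma {1..} (\<lambda>n. {d. d dvd n})"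
    moreover obtain n d where nd: "b = (n, d)" by (cases b)
    ultimately have n: "n \<ge> 1" "d dvd n" by simp_all
    from n(2) obtain m where "n = d * m" by (rule dvdE)
    with n nd have b: "b = (d * m, d)" "d * m \<ge> 1" by simp_all
    hence "d > 0" "m > 0" by (auto intro!: Nat.gr0I)
    thus "(case b of (n, d) \<Rightarrow> (d, n div d)) \<in> {1..} \<times> {1..}"
       "(case case b of (n, d) \<Rightarrow> (d, n div d) of (d, m) \<Rightarrow> (d * m, d)) = b"
      by (simp_all add: b(1) Suc_le_eq)
  next
    fix a :: "nat \<times> nat" assume "a \<in> {1..} \<times> {1..}"
    then obtain d m where a: "a = (d, m)" "d > 0" "m > 0" by (auto simp: Suc_le_eq)
    thus "(case case a of (d, m) \<Rightarrow> (d * m, d) of (n, d) \<Rightarrow> (d, n div d)) = a"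
      "(case a of (d, m) \<Rightarrow> (d * m, d)) \<in> Sigma {1..} (\<lambda>n. {d. d dvd n})"
      by (simp_all add: Suc_le_eq)
  qed simp
  hence "((\<lambda>(n,d). mangoldt d * npow (real n) s) has_sum (mangoldt_series s * (zeta_reg s + 1 / (s - 1))))
       (Sigma {1..} (\<lambda>n. {d. d dvd n}))" by (rule iffD1[OF _ prod])
  hence "((\<lambda>n. of_real (ln (real n)) * npow n s) has_sum (mangoldt_series s * (zeta_reg s + 1 / (s - 1)))) {1..}"
  proof (rule has_sum_SigmaD)
    fix n :: nat assume n: "n \<in> {1..}"
    have "((\<lambda>d. mangoldt d * npow n s) has_sum (\<Sum>d | d dvd n. mangoldt d * npow n s)) {d. d dvd n}"
      using n by (intro has_sum_finite finite_divisors_nat) simp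
    also have "(\<Sum>d | d dvd n. mangoldt d * npow n s) = of_real (ln (real n)) * npow n s"
      using n by (simp add: mangoldt_sum flip: sum_distrib_right)
    finally show "((\<lambda>y. case (n, y) of (n, d) \<Rightarrow> mangoldt d * npow n s) has_sum of_real (ln (real n)) * npow n s) {d. d dvd n}"
      by simp
  qed
  hence "(\<lambda>n. of_real (ln (Suc n)) * npow (Suc n) s) sums (mangoldt_series s * (zeta_reg s + 1 / (s - 1)))"
    by (intro has_sum_imp_sums) (simp only: has_sum_reindex_bij_betw[OF bij, of "\<lambda>n. of_real (ln (real n)) * npow (real n) s"])
  thus ?thesis by (rule sums_unique2[OF _ zeta_deriv_sums[OF s]])
qed

lemma deriv_zeta_num:
  assumes "Re s > 0"
  shows "deriv zeta_num s = zeta_reg s + (s - 1) * deriv zeta_reg s"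
proof (rule DERIV_imp_deriv)
  have "(zeta_reg has_field_derivative deriv zeta_reg s) (at s)"
    by (rule holomorphic_derivI[OF zeta_reg_aux(1)]) (use assms in \<open>auto simp: open_halfspace_Re_gt\<close>)
  thus "(zeta_num has_field_derivative zeta_reg s + (s - 1) * deriv zeta_reg s) (at s)"
    unfolding zeta_num_def[abs_def] by (auto intro!: derivative_eq_intros)
qed

text \<open>The logarithmic derivative of \<zeta>(s) = zeta_num(s) / (s - 1). The pole at 1 is split
  off explicitly, and the remaining quotient makes sense for Re s > 0 wherever
  \<open>zeta_num\<close> does not vanish.\<close>

lemma mangoldt_series_eq:
  assumes s: "Re s > 1" "zeta_num s \<noteq> 0"
  shows "mangoldt_series s = 1 / (s - 1) - deriv zeta_num s / zeta_num s"
proof -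
  have s1: "s - 1 \<noteq> 0" using s by auto
  have "zeta_reg s + 1 / (s - 1) = zeta_num s / (s - 1)"
    using s1 by (simp add: zeta_num_def field_simps)
  hence *: "mangoldt_series s * (zeta_num s / (s - 1)) = 1 / (s - 1)\<^sup>2 - deriv zeta_reg s"
    using mangoldt_times_zeta[OF s(1)] by simp
  have "mangoldt_series s * zeta_num s * (s - 1) = (mangoldt_series s * (zeta_num s / (s - 1))) * (s - 1)\<^sup>2"
    using s1 by (simp add: power2_eq_square)
  also have "\<dots> = 1 - (s - 1)\<^sup>2 * deriv zeta_reg s"
    unfolding * using s1 by (simp add: algebra_simps)
  also have "\<dots> = zeta_num s - (s - 1) * deriv zeta_num s"
    unfolding deriv_zeta_num[of s, OF less_trans[OF zero_less_one s(1)]]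
    by (simp add: zeta_num_def algebra_simps power2_eq_square)
  finally show ?thesis using s s1 by (simp add: field_simps)
qed

section \<open>Residues of the logarithmic derivative and non-vanishing of zeta\<close>

text \<open>Near s0 one has f(w) = (w - s0)^m g(w) with g zero-free, hence f'/f = m / (w - s0) +
  g'/g. The approach is from the right because the Dirichlet series converge there.\<close>

lemma logderiv_residue_right:
  assumes f: "f holomorphic_on S" and S: "open S" "connected S" and s0: "s0 \<in> S"
    and nz: "\<exists>z\<in>S. f z \<noteq> 0"
  obtains m :: nat where "m = 0 \<longleftrightarrow> f s0 \<noteq> 0"
    "\<forall>\<^sub>F e in at_right 0. f (s0 + of_real e) \<noteq> 0"
    "((\<lambda>e. of_real e * deriv f (s0 + of_real e) / f (s0 + of_real e)) \<longlongrightarrow> of_nat m) (at_right 0)"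
proof -
  have "\<exists>g r (m::nat). (m = 0 \<longleftrightarrow> f s0 \<noteq> 0) \<and> r > 0 \<and> g holomorphic_on ball s0 r \<and>
      (\<forall>w\<in>ball s0 r. f w = (w - s0) ^ m * g w \<and> g w \<noteq> 0)"
  proof (cases "f s0 = 0")
    case True
    have "\<not> f constant_on S"
    proof
      assume "f constant_on S"
      then obtain c where "\<And>x. x \<in> S \<Longrightarrow> f x = c" unfolding constant_on_def by blast
      thus False using nz True s0 by metis
    qed
    then obtain g r m where "0 < m" "0 < r" "g holomorphic_on ball s0 r" 
      "\<And>w. w \<in> ball s0 r \<Longrightarrow> f w = (w - s0) ^ m * g w" "\<And>w. w \<in> ball s0 r \<Longrightarrow> g w \<noteq> 0"
      using holomorphic_factor_zero_nonconstant[OF f S s0 True] by metis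
    thus ?thesis using True by (intro exI[of _ g] exI[of _ r] exI[of _ m]) auto
  next
    case False
    have "continuous (at s0) f"
      using f S s0 by (metis continuous_on_eq_continuous_at holomorphic_on_imp_continuous_on)
    then obtain r1 where r1: "r1 > 0" "\<And>w. dist s0 w < r1 \<Longrightarrow> f w \<noteq> 0"
      using continuous_at_avoid[of s0 f 0] False by blast
    obtain r2 where r2: "r2 > 0" "ball s0 r2 \<subseteq> S" using S s0 open_contains_ball by blast
    have "f holomorphic_on ball s0 (min r1 r2)"
      using r2 by (intro holomorphic_on_subset[OF f]) auto
    thus ?thesis
      by (intro exI[of _ f] exI[of _ "min r1 r2"] exI[of _ 0]) (use False r1 r2 in auto)
  qed
  then obtain g r and m :: nat where *: "(m = 0 \<longleftrightarrow> f s0 \<noteq> 0) \<and> r > 0 \<and> g holomorphic_on ball s0 r \<and>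
      (\<forall>w\<in>ball s0 r. f w = (w - s0) ^ m * g w \<and> g w \<noteq> 0)"
    by (elim exE) (rule that)
  note m = *[THEN conjunct1] and r = *[THEN conjunct2, THEN conjunct1]
    and g = *[THEN conjunct2, THEN conjunct2, THEN conjunct1]
  note fg = *[THEN conjunct2, THEN conjunct2, THEN conjunct2, THEN bspec, THEN conjunct1]
    and gnz = *[THEN conjunct2, THEN conjunct2, THEN conjunct2, THEN bspec, THEN conjunct2]
  have ev: "\<forall>\<^sub>F e in at_right 0. e > 0 \<and> s0 + of_real e \<in> ball s0 r"
    using eventually_at_right_less[of 0] eventually_at_right_real[OF r]
    by eventually_elim (auto simp: dist_norm)
  have lim: "((\<lambda>e. of_real e * (deriv g (s0 + of_real e) / g (s0 + of_real e)) + of_nat m) \<longlongrightarrow> 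
      of_real 0 * (deriv g s0 / g s0) + of_nat m) (at_right 0)"
  proof -
    have "deriv g holomorphic_on ball s0 r" by (intro holomorphic_deriv g) auto
    hence "isCont (deriv g) s0" "isCont g s0"
      using g r holomorphic_on_imp_continuous_on continuous_on_eq_continuous_at[OF open_ball]
      by (metis centre_in_ball)+
    moreover have "((\<lambda>e::real. s0 + of_real e) \<longlongrightarrow> s0 + of_real 0) (at_right 0)"
      by (intro tendsto_intros)
    hence "((\<lambda>e::real. s0 + of_real e) \<longlongrightarrow> s0) (at_right 0)" by simp
    ultimately have "((\<lambda>e::real. deriv g (s0 + of_real e)) \<longlongrightarrow> deriv g s0) (at_right 0)"
      "((\<lambda>e::real. g (s0 + of_real e)) \<longlongrightarrow> g s0) (at_right 0)"
      by (auto intro: isCont_tendsto_compose)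
    thus ?thesis using gnz[of s0] r by (intro tendsto_intros) simp_all
  qed
  have eq: "of_real e * deriv f (s0 + of_real e) / f (s0 + of_real e) =
      of_real e * (deriv g (s0 + of_real e) / g (s0 + of_real e)) + of_nat m"
    if e: "e > 0" "s0 + of_real e \<in> ball s0 r" for e
  proof -
    define w where "w = s0 + of_real e"
    have w: "w \<in> ball s0 r" "w - s0 = of_real e" using e by (auto simp: w_def)
    have "(g has_field_derivative deriv g w) (at w)"
      by (rule holomorphic_derivI[OF g _ w(1)]) auto
    hence "((\<lambda>w. (w - s0) ^ m * g w) has_field_derivative
        (of_nat m * (w - s0) ^ (m - 1) * g w + (w - s0) ^ m * deriv g w)) (at w)"
      by (auto intro!: derivative_eq_intros)
    hence "(f has_field_derivative (of_nat m * (w - s0) ^ (m - 1) * g w + (w - s0) ^ m * deriv g w)) (at w)"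
      by (rule has_field_derivative_transform_within_open[OF _ _ w(1)]) (use fg in auto)
    hence "deriv f w = of_nat m * (w - s0) ^ (m - 1) * g w + (w - s0) ^ m * deriv g w"
      by (rule DERIV_imp_deriv)
    moreover have "f w = (w - s0) ^ m * g w" using fg w by blast
    \<comment> \<open>For m = 0 the truncated exponent m - 1 is harmless, as both sides
      vanish.\<close>
    moreover have "of_real e * (of_nat m * (w - s0) ^ (m - 1)) = of_nat m * (w - s0) ^ m"
      unfolding w(2) by (cases m) auto
    ultimately show ?thesis
      unfolding w_def [symmetric] using gnz[OF w(1)] e(1) w(2) by (simp add: field_simps)
  qed
  show ?thesis
  proof (rule that[of m, OF m])
    show "\<forall>\<^sub>F e in at_right 0. f (s0 + of_real e) \<noteq> 0"
      using ev by eventually_elim (use fg gnz in auto)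
    have "((\<lambda>e. of_real e * (deriv g (s0 + of_real e) / g (s0 + of_real e)) + of_nat m) \<longlongrightarrow> of_nat m) (at_right 0)"
      using lim by simp
    thus "((\<lambda>e. of_real e * deriv f (s0 + of_real e) / f (s0 + of_real e)) \<longlongrightarrow> of_nat m) (at_right 0)"
      by (rule Lim_transform_eventually) (use ev in eventually_elim, use eq in auto)
  qed
qed

lemma zeta_num_1: "zeta_num 1 = 1"
  by (simp add: zeta_num_def)

text \<open>The limit \<open>a\<close> is the residue of \<open>-\<zeta>'/\<zeta>\<close> at \<open>s\<close>.\<close>
lemma mangoldt_series_residue:
  assumes s: "Re s \<ge> 1"
  obtains a :: real where "((\<lambda>e. e * Re (mangoldt_series (s + of_real e))) \<longlongrightarrow> a) (at_right 0)"
    "a \<le> 1" "s \<noteq> 1 \<Longrightarrow> a \<le> 0" "zeta_num s = 0 \<Longrightarrow> a \<le> -1"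
proof -
  have in_S: "s \<in> {s. Re s > 0}" using s by simp
  have nz: "\<exists>z\<in>{s. Re s > 0}. zeta_num z \<noteq> 0"
    by (rule bexI[of _ 1]) (simp_all add: zeta_num_1)
  obtain m :: nat where m: "m = 0 \<longleftrightarrow> zeta_num s \<noteq> 0"
    and ev: "\<forall>\<^sub>F e in at_right 0. zeta_num (s + of_real e) \<noteq> 0"
    and lim: "((\<lambda>e. of_real e * deriv zeta_num (s + of_real e) / zeta_num (s + of_real e)) \<longlongrightarrow> of_nat m) (at_right 0)"
    by (rule logderiv_residue_right[OF zeta_num_holomorphic open_halfspace_Re_gt
          convex_connected[OF convex_halfspace_Re_gt] in_S nz]) (rule that)
  define r :: complex where "r = (if s = 1 then 1 else 0)"
  have "((\<lambda>e. of_real e / (s + of_real e - 1)) \<longlongrightarrow> r) (at_right 0)"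
  proof (cases "s = 1")
    case True
    have "\<forall>\<^sub>F e::real in at_right 0. (1::complex) = of_real e / (s + of_real e - 1)"
      using eventually_at_right_less[of 0] by eventually_elim (use True in auto)
    from Lim_transform_eventually[OF tendsto_const this] show ?thesis using True by (simp add: r_def)
  next
    case False
    have "((\<lambda>e::real. of_real e / (s + of_real e - 1)) \<longlongrightarrow> of_real 0 / (s + of_real 0 - 1)) (at_right 0)"
      using False by (intro tendsto_intros) auto
    thus ?thesis using False by (simp add: r_def)
  qed
  from tendsto_diff[OF this lim]
  have "((\<lambda>e. of_real e * mangoldt_series (s + of_real e)) \<longlongrightarrow> r - of_nat m) (at_right 0)"
  proof (rule Lim_transform_eventually)
    show "\<forall>\<^sub>F e in at_right 0. of_real e / (s + of_real e - 1) - of_real e * deriv zeta_num (s + of_real e) / zeta_num (s + of_real e) =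
            of_real e * mangoldt_series (s + of_real e)"
      using ev eventually_at_right_less[of 0]
    proof eventually_elim
      case (elim e)
      have "Re (s + of_real e) > 1" using s elim by simp
      from mangoldt_series_eq[OF this elim(1)] show ?case by (simp add: right_diff_distrib)
    qed
  qed
  from tendsto_Re[OF this]
  have "((\<lambda>e. e * Re (mangoldt_series (s + of_real e))) \<longlongrightarrow> Re r - real m) (at_right 0)" by simp
  thus ?thesis
  proof (rule that)
    show "zeta_num s = 0 \<Longrightarrow> Re r - real m \<le> -1"
      using m zeta_num_1 by (auto simp: r_def)
  qed (auto simp: r_def)
qed

text \<open>With \<theta> = t ln n, the identity 3 + 4 cos \<theta> + cos 2\<theta> = 2 (1 + cos
  \<theta>)^2 makes every term nonnegative.\<close>

lemma mangoldt_series_341: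
  assumes "\<sigma> > 1"
  shows "0 \<le> 3 * Re (mangoldt_series (of_real \<sigma>)) + 4 * Re (mangoldt_series (Complex \<sigma> t)) +
    Re (mangoldt_series (Complex \<sigma> (2 * t)))"
proof (rule sums_le[OF _ sums_zero])
  have S: "(\<lambda>n. Re (mangoldt (Suc n) * npow (Suc n) s)) sums Re (mangoldt_series s)" if "Re s = \<sigma>" for s
    using that assms by (intro sums_Re mangoldt_sums) auto
  show "(\<lambda>n. 3 * Re (mangoldt (Suc n) * npow (Suc n) (of_real \<sigma>)) + 4 * Re (mangoldt (Suc n) * npow (Suc n) (Complex \<sigma> t)) +
      Re (mangoldt (Suc n) * npow (Suc n) (Complex \<sigma> (2 * t)))) sums
    (3 * Re (mangoldt_series (of_real \<sigma>)) + 4 * Re (mangoldt_series (Complex \<sigma> t)) +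
    Re (mangoldt_series (Complex \<sigma> (2 * t))))"
    by (intro sums_add sums_mult S) auto
  fix n
  let ?L = "ln (real (Suc n))"
  have re: "Re (mangoldt (Suc n) * npow (Suc n) (Complex \<sigma> u)) = mangoldt (Suc n) * exp (- (\<sigma> * ?L)) * cos (u * ?L)" for u
    by (simp add: npow_def Re_exp)
  have double: "cos (2 * t * ?L) = 2 * (cos (t * ?L))\<^sup>2 - 1"
    using cos_double_cos[of "t * ?L"] by (simp only: mult.assoc)
  have "3 * Re (mangoldt (Suc n) * npow (Suc n) (Complex \<sigma> 0)) + 4 * Re (mangoldt (Suc n) * npow (Suc n) (Complex \<sigma> t)) +
      Re (mangoldt (Suc n) * npow (Suc n) (Complex \<sigma> (2 * t))) =
      2 * (mangoldt (Suc n) * exp (- (\<sigma> * ?L)) * (1 + cos (t * ?L))\<^sup>2)"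
    unfolding re double by (simp add: power2_eq_square algebra_simps)
  also have "\<dots> \<ge> 0"
    by (intro mult_nonneg_nonneg mangoldt_nonneg) auto
  finally show "0 \<le> 3 * Re (mangoldt (Suc n) * npow (Suc n) (of_real \<sigma>)) + 4 * Re (mangoldt (Suc n) * npow (Suc n) (Complex \<sigma> t)) +
      Re (mangoldt (Suc n) * npow (Suc n) (Complex \<sigma> (2 * t)))"
    by (simp only: complex_of_real_def)
qed

text \<open>Multiplying the 3-4-1 inequality by e and letting e tend to 0 gives 0 <= 3a + 4b + c for
  the residues at \<sigma>, \<sigma> + it and \<sigma> + 2it. A zero at \<sigma> + it forces b <=
  -1. Only a pole at 1 can make a or c positive, and the two outer points are not both 1, so the sum
  is at most 3 - 4 < 0.\<close>

theorem zeta_num_nonzero: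
  assumes s: "Re s \<ge> 1"
  shows "zeta_num s \<noteq> 0"
proof
  assume zero: "zeta_num s = 0"
  define \<sigma> t where "\<sigma> = Re s" and "t = Im s"
  have s_eq: "s = Complex \<sigma> t" by (simp add: \<sigma>_def t_def)
  have \<sigma>: "\<sigma> \<ge> 1" using s by (simp add: \<sigma>_def)
  have shift: "Complex \<sigma> u + of_real e = Complex (\<sigma> + e) u" for u e
    by (simp add: complex_eq_iff)
  obtain a where a: "((\<lambda>e. e * Re (mangoldt_series (Complex \<sigma> 0 + of_real e))) \<longlongrightarrow> a) (at_right 0)" 
      "a \<le> 1" "Complex \<sigma> 0 \<noteq> 1 \<Longrightarrow> a \<le> 0"
    using mangoldt_series_residue[of "Complex \<sigma> 0"] \<sigma> by auto
  obtain b where b: "((\<lambda>e. e * Re (mangoldt_series (Complex \<sigma> t + of_real e))) \<longlongrightarrow> b) (at_right 0)" "b \<le> -1"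
    using mangoldt_series_residue[of "Complex \<sigma> t"] \<sigma> zero s_eq by auto
  obtain c where c: "((\<lambda>e. e * Re (mangoldt_series (Complex \<sigma> (2 * t) + of_real e))) \<longlongrightarrow> c) (at_right 0)"
      "c \<le> 1" "Complex \<sigma> (2 * t) \<noteq> 1 \<Longrightarrow> c \<le> 0"
    using mangoldt_series_residue[of "Complex \<sigma> (2 * t)"] \<sigma> by auto
  have "0 \<le> 3 * a + 4 * b + c"
  proof (rule tendsto_lowerbound)
    show "((\<lambda>e. 3 * (e * Re (mangoldt_series (Complex \<sigma> 0 + of_real e))) + 
        4 * (e * Re (mangoldt_series (Complex \<sigma> t + of_real e))) +
        e * Re (mangoldt_series (Complex \<sigma> (2 * t) + of_real e))) \<longlongrightarrow> 3 * a + 4 * b + c) (at_right 0)"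
      by (intro tendsto_intros a b c)
    show "\<forall>\<^sub>F e in at_right 0. 0 \<le> 3 * (e * Re (mangoldt_series (Complex \<sigma> 0 + of_real e))) + 
        4 * (e * Re (mangoldt_series (Complex \<sigma> t + of_real e))) +
        e * Re (mangoldt_series (Complex \<sigma> (2 * t) + of_real e))"
      using eventually_at_right_less[of 0]
    proof eventually_elim
      case (elim e)
      have "0 \<le> e * (3 * Re (mangoldt_series (of_real (\<sigma> + e))) + 4 * Re (mangoldt_series (Complex (\<sigma> + e) t)) +
         Re (mangoldt_series (Complex (\<sigma> + e) (2 * t))))"
        using elim \<sigma> by (intro mult_nonneg_nonneg mangoldt_series_341) auto
      moreover have "Complex \<sigma> 0 + of_real e = of_real (\<sigma> + e)" by (simp add: complex_eq_iff)
      ultimately show ?case unfolding shift[of t] shift[of "2 * t"] by (simp add: algebra_simps)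
    qed
  qed simp
  moreover have "s \<noteq> 1" using zero zeta_num_1 by auto
  hence "Complex \<sigma> (2 * t) \<noteq> 1 \<or> Complex \<sigma> 0 \<noteq> 1"
    unfolding s_eq by (auto simp: complex_eq_iff)
  ultimately show False using a b c by auto
qed

section \<open>The transform of \<psi>(x) - floor(x) and its convergence at s = 1\<close>

definition psi_error :: "nat \<Rightarrow> complex" where
  "psi_error n = of_real (cheb_psi n - real n)"

lemma norm_psi_error_le: "norm (psi_error n) \<le> 5 * real n"
  using cheb_psi_le[of n] cheb_psi_nonneg[of n] by (simp add: psi_error_def flip: of_real_diff)

text \<open>Abel summation, the increments of \<psi>(n) - n being the von Mangoldt values minus
  1.\<close>

lemma psi_error_sum_by_parts:
  "(\<Sum>n<N. psi_error (Suc n) * (npow (Suc n) s - npow (Suc (Suc n)) s)) =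
     (\<Sum>n<N. (mangoldt (Suc n) - 1) * npow (Suc n) s) - psi_error N * npow (Suc N) s"
proof (induction N)
  case 0
  show ?case by (simp add: psi_error_def cheb_psi_def)
next
  case (Suc N)
  have *: "psi_error (Suc N) = psi_error N + mangoldt (Suc N) - 1"
    by (simp add: psi_error_def cheb_psi_Suc)
  show ?case unfolding sum.lessThan_Suc Suc.IH * by (simp add: algebra_simps)
qed

text \<open>With \<open>s = z + 1\<close> this is \<open>- (\<zeta>'(s) / \<zeta>(s) + \<zeta>(s)) / s\<close>, where the poles at \<open>s = 1\<close> have cancelled.\<close>
definition psi_transform :: "complex \<Rightarrow> complex" where
  "psi_transform z = - (deriv zeta_num (z + 1) / zeta_num (z + 1) + zeta_reg (z + 1)) / (z + 1)"

text \<open>Since s times the n-th weight is n^(-s) - (n + 1)^(-s), Abel summation leads to the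
  series of -\<zeta>'/\<zeta> - \<zeta>. Its boundary term vanishes in the limit by Chebyshev's
  bound, and the two terms 1 / (s - 1) cancel.\<close>

lemma psi_error_sums:
  assumes z: "Re z > 0"
  shows "(\<lambda>n. psi_error (Suc n) * newman_weight (Suc n) z) sums psi_transform z"
proof -
  define s where "s = z + 1"
  have s: "Re s > 1" "s \<noteq> 0" "s \<noteq> 1" using z by (auto simp: s_def complex_eq_iff)
  have weight: "npow (Suc n) s - npow (Suc (Suc n)) s = s * newman_weight (Suc n) z" for n
    using newman_weight_eq[of "Suc n" z] by (simp add: s_def)
  have "(\<lambda>N. psi_error N * npow (Suc N) s) \<longlonglongrightarrow> 0"
  proof (rule Lim_null_comparison)
    show "\<forall>\<^sub>F N in sequentially. norm (psi_error N * npow (Suc N) s) \<le> 5 * real N * real (Suc N) powr (- Re s)"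
      unfolding norm_mult by (intro always_eventually allI mult_mono norm_psi_error_le) (simp_all add: norm_npow)
    show "(\<lambda>N. 5 * real N * real (Suc N) powr (- Re s)) \<longlonglongrightarrow> 0"
      using s by real_asymp
  qed
  moreover have "(\<lambda>n. mangoldt (Suc n) * npow (Suc n) s - npow (Suc n) s) sums
      (mangoldt_series s - (zeta_reg s + 1 / (s - 1)))"
    by (intro sums_diff mangoldt_sums zeta_sums s)
  ultimately have "(\<lambda>N. (\<Sum>n<N. (mangoldt (Suc n) - 1) * npow (Suc n) s) - psi_error N * npow (Suc N) s) \<longlonglongrightarrow>
      mangoldt_series s - (zeta_reg s + 1 / (s - 1)) - 0"
    unfolding sums_def by (intro tendsto_diff) (simp_all add: algebra_simps)
  hence "(\<lambda>n. psi_error (Suc n) * (npow (Suc n) s - npow (Suc (Suc n)) s)) sums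
      (mangoldt_series s - (zeta_reg s + 1 / (s - 1)))"
    unfolding sums_def psi_error_sum_by_parts by simp
  also have "(\<lambda>n. psi_error (Suc n) * (npow (Suc n) s - npow (Suc (Suc n)) s)) =
       (\<lambda>n. s * (psi_error (Suc n) * newman_weight (Suc n) z))"
    unfolding weight by (simp only: mult.left_commute)
  also have "mangoldt_series s - (zeta_reg s + 1 / (s - 1)) = - (deriv zeta_num s / zeta_num s + zeta_reg s)"
    using s by (subst mangoldt_series_eq) (auto intro!: zeta_num_nonzero)
  finally have "(\<lambda>n. s * (psi_error (Suc n) * newman_weight (Suc n) z) / s) sums
      (- (deriv zeta_num s / zeta_num s + zeta_reg s) / s)"
    by (rule sums_divide)
  thus ?thesis using s by (simp add: psi_transform_def s_def)
qed

theorem psi_error_summable: "summable (\<lambda>n. (cheb_psi (Suc n) - real (Suc n)) / (real (Suc n) * real (Suc (Suc n))))"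
proof -
  \<comment> \<open>Re z > -1 keeps z + 1 inside the domain of continuation and away from 0.
    Non-vanishing of zeta puts the whole closed right half plane into this open set.\<close>
  define U where "U = {z. Re z > -1} \<inter> (\<lambda>z. zeta_num (z + 1)) -` (- {0})"
  have holo: "(\<lambda>z. zeta_num (z + 1)) holomorphic_on {z. Re z > -1}"
    "(\<lambda>z. zeta_reg (z + 1)) holomorphic_on {z. Re z > -1}"
    "(\<lambda>z. deriv zeta_num (z + 1)) holomorphic_on {z. Re z > -1}"
    by (rule holomorphic_on_compose_gen[unfolded o_def, of "\<lambda>z. z + 1" _ _ "{s. Re s > 0}"];
        auto intro!: holomorphic_intros zeta_num_holomorphic zeta_reg_aux holomorphic_deriv open_halfspace_Re_gt)+
  have "open {z::complex. Re z > -1}" by (rule open_halfspace_Re_gt)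
  hence "open U"
    unfolding U_def using holomorphic_on_imp_continuous_on[OF holo(1)]
    by (intro continuous_open_preimage) auto
  moreover have "{z. Re z \<ge> 0} \<subseteq> U"
    by (auto simp: U_def intro!: zeta_num_nonzero)
  moreover have "psi_transform holomorphic_on U"
    unfolding psi_transform_def
    by (intro holomorphic_intros holo[THEN holomorphic_on_subset]) (auto simp: U_def complex_eq_iff)
  ultimately have "(\<lambda>n. psi_error (Suc n) * newman_weight (Suc n) 0) sums psi_transform 0"
    using norm_psi_error_le psi_error_sums by (rule newman_tauberian)
  hence "summable (\<lambda>n. Re (psi_error (Suc n) * newman_weight (Suc n) 0))"
    by (intro summable_Re sums_summable)
  moreover have "psi_error (Suc n) * newman_weight (Suc n) 0 = 
      of_real ((cheb_psi (Suc n) - real (Suc n)) / (real (Suc n) * real (Suc (Suc n))))" for n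
  proof -
    \<comment> \<open>At z = 0 the weight is the integral of x^(-2) over one unit interval.\<close>
    have "newman_weight (Suc n) 0 = of_real (1 / real (Suc n) - 1 / real (Suc (Suc n)))"
      using newman_weight_eq[of "Suc n" 0] by (simp add: npow_1_right)
    also have "1 / real (Suc n) - 1 / real (Suc (Suc n)) = 1 / (real (Suc n) * real (Suc (Suc n)))"
      by (simp add: field_simps)
    finally have "newman_weight (Suc n) 0 = of_real (1 / (real (Suc n) * real (Suc (Suc n))))" .
    thus ?thesis by (simp only: psi_error_def of_real_mult [symmetric]) simp
  qed
  ultimately show ?thesis by simp
qed

section \<open>The prime number theorem\<close>

lemma sum_telescope_inverse:
  assumes "m \<le> n" "1 \<le> m"
  shows "(\<Sum>k=m..<n. 1 / (real k * real (Suc k))) = 1 / real m - 1 / real n"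
  using assms(1)
proof (induction n rule: dec_induct)
  case (step n)
  have "1 / (real n * real (Suc n)) = 1 / real n - 1 / real (Suc n)"
    using step assms(2) by (simp add: field_simps)
  thus ?case using step by simp
qed simp

text \<open>If F n > (1 + e) n, monotonicity keeps F k - k >= e n / 2 for all k from n to n + e n /
  2, so that block of the series is at least e^2 / 8, against the Cauchy criterion. If F n < (1 - e)
  n, the block just below n does the same with the opposite sign.\<close>

lemma asymptotic_id_if_summable:
  fixes F :: "nat \<Rightarrow> real"
  assumes mono: "\<And>m n. m \<le> n \<Longrightarrow> F m \<le> F n"
    and sm: "summable (\<lambda>n. (F (Suc n) - real (Suc n)) / (real (Suc n) * real (Suc (Suc n))))"
  shows "(\<lambda>n. F n / n) \<longlonglongrightarrow> 1"
proof -
  define g where "g = (\<lambda>k. (F k - real k) / (real k * real (Suc k)))"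
  have "summable (\<lambda>n. g (Suc n))" using sm by (simp only: g_def)
  hence g: "summable g" by (simp only: summable_Suc_iff)
  have key: "\<forall>\<^sub>F n in sequentially. \<bar>F n / n - 1\<bar> \<le> e" if e: "0 < e" "e < 1" for e
  proof -
    obtain N where N: "\<And>m n. m \<ge> N \<Longrightarrow> \<bar>sum g {m..<n}\<bar> < e\<^sup>2 / 8"
      using g e unfolding summable_Cauchy by (metis real_norm_def divide_pos_pos zero_less_numeral zero_less_power)
    show ?thesis
      \<comment> \<open>The lower block starts no earlier than n / 2, hence beyond N. The condition
        e n >= 4 absorbs the rounding: the block still has length at least e n / 4.\<close>
      using eventually_ge_at_top[of "2 * N + 1"] eventually_ge_at_top[of "nat \<lceil>4 / e\<rceil>"]
    proof eventually_elim
      case (elim n)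
      have n: "n \<ge> 1" "real n \<ge> 1" "n \<ge> N" "real n \<ge> 2 * real N" "real n \<ge> 4 / e"
        using elim by linarith+
      have en: "e * real n \<ge> 4" using n(5) e by (simp add: field_simps)
      have "F n \<le> (1 + e) * n"
      proof (rule ccontr)
        assume "\<not> F n \<le> (1 + e) * n"
        hence F: "F n > (1 + e) * n" by simp
        \<comment> \<open>The added 1 makes M at least n + e n / 2, while every k < M still
          satisfies k <= n + e n / 2.\<close>
        define M where "M = n + nat \<lfloor>e * n / 2\<rfloor> + 1"
        have M: "real M \<ge> n + e * n / 2" "n \<le> M"
          unfolding M_def using e n by linarith+
        have "e * n / 2 * (1 / real n - 1 / real M) = (\<Sum>k=n..<M. e * n / 2 * (1 / (real k * real (Suc k))))"
          using n M by (simp only: sum_distrib_left [symmetric] sum_telescope_inverse)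
        also have "\<dots> \<le> sum g {n..<M}"
        proof (rule sum_mono)
          fix k assume k: "k \<in> {n..<M}"
          have "k \<le> n + nat \<lfloor>e * n / 2\<rfloor>" using k by (simp add: M_def)
          moreover have "real (nat \<lfloor>e * n / 2\<rfloor>) \<le> e * n / 2"
            using e by (intro of_nat_floor) simp
          ultimately have "real k \<le> n + e * n / 2" by linarith
          moreover have "F n \<le> F k" using k by (intro mono) simp
          ultimately have "e * n / 2 \<le> F k - real k" using F by (simp add: algebra_simps)
          hence "e * n / 2 / (real k * real (Suc k)) \<le> g k"
            unfolding g_def by (intro divide_right_mono) auto
          thus "e * n / 2 * (1 / (real k * real (Suc k))) \<le> g k" by simp
        qed
        also have "\<dots> < e\<^sup>2 / 8" using N[of n M] n by linarith
        finally have less: "e * n / 2 * (1 / real n - 1 / real M) < e\<^sup>2 / 8" .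
        have "1 / real M \<le> 1 / (n + e * n / 2)"
          using M n e by (intro divide_left_mono mult_pos_pos add_pos_nonneg) auto
        hence "e * n / 2 * (1 / real n - 1 / (n + e * n / 2)) \<le> e * n / 2 * (1 / real n - 1 / real M)"
          using e by (intro mult_left_mono) auto
        also have "e * n / 2 * (1 / real n - 1 / (n + e * n / 2)) = e\<^sup>2 / (4 + 2 * e)"
        proof -
          have "n + e * n / 2 = n * (1 + e / 2)" by (simp add: algebra_simps)
          thus ?thesis using n e by (simp add: divide_simps power2_eq_square) (simp add: algebra_simps)
        qed
        also have "e\<^sup>2 / (4 + 2 * e) \<ge> e\<^sup>2 / 8" using e by (intro divide_left_mono) auto
        finally show False using less by linarith
      qed
      moreover have "F n \<ge> (1 - e) * n"
      proof (rule ccontr)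
        assume "\<not> F n \<ge> (1 - e) * n"
        hence F: "F n < (1 - e) * n" by simp
        define m where "m = nat \<lceil>n - e * n / 2\<rceil>"
        have en2: "e * n \<le> n" using e n by simp
        have m: "real m \<ge> n - e * n / 2" "real m \<le> n - e * n / 2 + 1"
          unfolding m_def using en2 by linarith+
        have m': "m \<le> n" "m \<ge> N" "m \<ge> 1"
          using m n en2 en by linarith+
        have "e * n / 2 * (1 / real m - 1 / real n) = (\<Sum>k=m..<n. e * n / 2 * (1 / (real k * real (Suc k))))"
          using m' by (simp only: sum_distrib_left [symmetric] sum_telescope_inverse)
        also have "\<dots> \<le> (\<Sum>k=m..<n. - g k)"
        proof (rule sum_mono)
          fix k assume k: "k \<in> {m..<n}"
          hence "real m \<le> real k" by simp
          hence "real k \<ge> n - e * n / 2" using m by linarith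
          moreover have "F k \<le> F n" using k by (intro mono) simp
          ultimately have "e * n / 2 \<le> - (F k - real k)" using F by (simp add: algebra_simps)
          hence "e * n / 2 / (real k * real (Suc k)) \<le> - (F k - real k) / (real k * real (Suc k))"
            by (intro divide_right_mono) auto
          thus "e * n / 2 * (1 / (real k * real (Suc k))) \<le> - g k"
            unfolding g_def by (simp only: times_divide_eq_right mult_1_right minus_divide_left)
        qed
        also have "\<dots> = - sum g {m..<n}" by (simp add: sum_negf)
        also have "\<dots> < e\<^sup>2 / 8" using N[of m n] m' by linarith
        finally have less: "e * n / 2 * (1 / real m - 1 / real n) < e\<^sup>2 / 8" .
        have "e / 4 / n \<le> (real n - real m) / (n * n)"
        proof -
          have "e / 4 * n \<le> real n - real m" using m(2) en by linarith
          thus ?thesis using n by (simp add: field_simps)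
        qed
        also have "\<dots> \<le> (real n - real m) / (real m * n)"
          using m' n by (intro divide_left_mono mult_right_mono) auto
        also have "\<dots> = 1 / real m - 1 / real n" using m' n by (simp add: field_simps)
        finally have "e * n / 2 * (e / 4 / n) \<le> e * n / 2 * (1 / real m - 1 / real n)"
          using e by (intro mult_left_mono) auto
        moreover have "e * n / 2 * (e / 4 / n) = e\<^sup>2 / 8" using n by (simp add: power2_eq_square)
        ultimately show False using less by linarith
      qed
      ultimately show ?case using n by (simp add: abs_le_iff field_simps)
    qed
  qed
  show ?thesis
  proof (rule tendstoI)
    fix e :: real assume e: "e > 0"
    have "min (e / 2) (1 / 2) > 0" "min (e / 2) (1 / 2) < 1" using e by auto
    from key[OF this] show "\<forall>\<^sub>F n in sequentially. dist (F n / n) 1 < e"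
      by eventually_elim (use e in \<open>auto simp: dist_real_def\<close>)
  qed
qed

text \<open>The finitely many exceptions go into K. A bound for all n is wanted because the windows
  may start anywhere between 0 and X.\<close>

lemma affine_bound_if_asymptotic_id:
  fixes F :: "nat \<Rightarrow> real" and \<kappa> :: real
  assumes "(\<lambda>n. F n / n) \<longlonglongrightarrow> 1" "\<kappa> > 0"
  obtains K where "K \<ge> 0" "\<And>n. \<bar>F n - n\<bar> \<le> \<kappa> * n + K"
proof -
  have "\<forall>\<^sub>F n in sequentially. dist (F n / n) 1 < \<kappa> \<and> n \<ge> 1"
    using tendstoD[OF assms] eventually_ge_at_top[of 1] by (rule eventually_conj)
  then obtain n0 where n0: "\<And>n. n \<ge> n0 \<Longrightarrow> dist (F n / n) 1 < \<kappa>" "\<And>n. n \<ge> n0 \<Longrightarrow> n \<ge> 1"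
    by (auto simp: eventually_sequentially)
  define K where "K = (\<Sum>n<n0. \<bar>F n - n\<bar>)"
  show ?thesis
  proof (rule that[of K])
    show K0: "K \<ge> 0" by (simp add: K_def sum_nonneg)
    fix n :: nat
    show "\<bar>F n - n\<bar> \<le> \<kappa> * n + K"
    proof (cases "n < n0")
      case True
      hence "\<bar>F n - n\<bar> \<le> K" unfolding K_def by (intro member_le_sum) auto
      moreover have "0 \<le> \<kappa> * n" using assms by simp
      ultimately show ?thesis by linarith
    next
      case False
      hence n: "n \<ge> 1" "\<bar>F n / n - 1\<bar> < \<kappa>" using n0[of n] by (auto simp: dist_real_def)
      have "\<bar>F n - n\<bar> = \<bar>F n / n - 1\<bar> * n"
        using n by (simp add: field_simps flip: abs_mult_pos)
      also have "\<dots> \<le> \<kappa> * n" using n by (intro mult_right_mono) auto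
      finally show ?thesis using K0 by linarith
    qed
  qed
qed


theorem prime_number_theorem: "(\<lambda>n. cheb_theta n / n) \<longlonglongrightarrow> 1"
  by (rule cheb_theta_asymptotics[OF asymptotic_id_if_summable[OF cheb_psi_mono psi_error_summable]])

section \<open>Averaging over a window\<close>

text \<open>As \<open>card\<close> of an infinite set is 0, lower bounds for \<open>Upsilon\<close>
  depend on this. From floor(p^c) <= N follows p <= (N + 1)^(1/c).\<close>

lemma finite_Upsilon_pairs:
  assumes "c > 0"
  shows "finite {(p :: nat, q :: nat). prime p \<and> prime q \<and> int N = \<lfloor>real p powr c\<rfloor> + int q}"
proof (rule finite_subset)
  show "{(p, q). prime p \<and> prime q \<and> int N = \<lfloor>real p powr c\<rfloor> + int q}
      \<subseteq> {..nat \<lfloor>(real N + 1) powr (1 / c)\<rfloor>} \<times> {..N}"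
  proof clarify
    fix p q assume N: "int N = \<lfloor>real p powr c\<rfloor> + int q"
    moreover have "\<lfloor>real p powr c\<rfloor> \<ge> 0" by simp
    ultimately have "q \<le> N" "real p powr c \<le> real N + 1" by linarith+
    hence "(real p powr c) powr (1 / c) \<le> (real N + 1) powr (1 / c)"
      using assms by (intro powr_mono2) auto
    hence "real p \<le> (real N + 1) powr (1 / c)" using assms by (simp add: powr_powr)
    with \<open>q \<le> N\<close> show "p \<in> {..nat \<lfloor>(real N + 1) powr (1 / c)\<rfloor>} \<and> q \<in> {..N}"
      by (simp add: le_nat_floor)
  qed
qed simp

lemma cheb_theta_diff:
  assumes "m \<le> n"
  shows "(\<Sum>q | prime q \<and> m < q \<and> q \<le> n. ln (real q)) = cheb_theta n - cheb_theta m"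
proof -
  have eq: "{q. prime q \<and> m < q \<and> q \<le> n} = {q. prime q \<and> q \<le> n} - {q. prime q \<and> q \<le> m}" by auto
  have "{q. prime q \<and> q \<le> m} \<subseteq> {q. prime q \<and> q \<le> n}" using assms by auto
  thus ?thesis unfolding cheb_theta_def eq by (rule sum_diff[rotated]) simp
qed

text \<open>A prime p <= P and a prime q in the window of length W above X - floor(p^c) have
  floor(p^c) + q in (X, X + W], so each such pair is counted on the right. Weighting pairs by ln p
  ln q turns their number into values of \<theta>; each weight is at most ln P ln (X + W).\<close>

lemma theta_le_sum_Upsilon:
  assumes c: "c > 0" and P: "real P \<le> real X powr (1 / c)" "P \<ge> 1"
    and B: "\<And>y. y \<le> X \<Longrightarrow> B \<le> cheb_theta (y + W) - cheb_theta y"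
  shows "cheb_theta P * B \<le> ln P * ln (real (X + W)) * (\<Sum>N\<in>{X<..X+W}. real (Upsilon c N))"
proof -
  define A where "A = (\<lambda>N. {(p :: nat, q :: nat). prime p \<and> prime q \<and> int N = \<lfloor>real p powr c\<rfloor> + int q})"
  \<comment> \<open>The natural subtraction is exact for p <= P, since then p^c <= X.\<close>
  define y where "y = (\<lambda>p. X - nat \<lfloor>real p powr c\<rfloor>)"
  define S where "S = Sigma {p. prime p \<and> p \<le> P} (\<lambda>p. {q. prime q \<and> y p < q \<and> q \<le> y p + W})"
  have floor_le: "\<lfloor>real p powr c\<rfloor> \<le> int X" if "p \<le> P" for p
  proof -
    have "real p powr c \<le> (real X powr (1 / c)) powr c"
      using that P c by (intro powr_mono2) auto
    also have "\<dots> = X" using c by (simp add: powr_powr)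
    finally show ?thesis by (simp add: floor_le_iff)
  qed
  have S_sub: "S \<subseteq> (\<Union>N\<in>{X<..X+W}. A N)"
  proof
    fix x assume "x \<in> S"
    then obtain p q where x: "x = (p, q)" "prime p" "p \<le> P" "prime q" "y p < q" "q \<le> y p + W"
      by (auto simp: S_def)
    define N where "N = nat \<lfloor>real p powr c\<rfloor> + q"
    have "nat \<lfloor>real p powr c\<rfloor> \<le> X" using floor_le[OF x(3)] by linarith
    hence "N \<in> {X<..X+W}" using x unfolding N_def y_def greaterThanAtMost_iff by linarith
    moreover have "x \<in> A N" using x by (simp add: A_def N_def)
    ultimately show "x \<in> (\<Union>N\<in>{X<..X+W}. A N)" by blast
  qed
  have "card S \<le> card (\<Union>N\<in>{X<..X+W}. A N)"
    using finite_Upsilon_pairs[OF c] by (intro card_mono S_sub) (auto simp: A_def)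
  also have "\<dots> \<le> (\<Sum>N\<in>{X<..X+W}. card (A N))" by (rule card_UN_le) simp
  also have "\<dots> = (\<Sum>N\<in>{X<..X+W}. Upsilon c N)" by (simp add: A_def Upsilon_def)
  finally have card_S: "real (card S) \<le> (\<Sum>N\<in>{X<..X+W}. real (Upsilon c N))"
    unfolding of_nat_sum [symmetric] of_nat_le_iff .
  have "cheb_theta P * B = (\<Sum>p | prime p \<and> p \<le> P. ln (real p) * B)"
    by (simp add: cheb_theta_def sum_distrib_right)
  also have "\<dots> \<le> (\<Sum>p | prime p \<and> p \<le> P. ln (real p) * (\<Sum>q | prime q \<and> y p < q \<and> q \<le> y p + W. ln (real q)))"
  proof (intro sum_mono mult_left_mono)
    show "B \<le> (\<Sum>q | prime q \<and> y p < q \<and> q \<le> y p + W. ln (real q))" for p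
      by (subst cheb_theta_diff) (auto intro!: B simp: y_def)
  qed (auto dest: prime_ge_1_nat)
  also have "\<dots> = (\<Sum>(p,q)\<in>S. ln (real p) * ln (real q))"
    unfolding S_def sum_distrib_left by (rule sum.Sigma) auto
  also have "\<dots> \<le> (\<Sum>(p,q)\<in>S. ln P * ln (real (X + W)))"
  proof (intro sum_mono, clarify)
    fix p q assume "(p, q) \<in> S"
    hence pq: "prime p" "p \<le> P" "prime q" "q \<le> X + W"
      by (auto simp: S_def y_def)
    thus "ln (real p) * ln (real q) \<le> ln P * ln (real (X + W))"
      using prime_ge_1_nat[of p] prime_ge_1_nat[of q] by (intro mult_mono) auto
  qed
  also have "\<dots> = ln P * ln (real (X + W)) * real (card S)" by simp
  also have "\<dots> \<le> ln P * ln (real (X + W)) * (\<Sum>N\<in>{X<..X+W}. real (Upsilon c N))"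
  proof (cases "X + W = 0")
    case False
    hence "real (X + W) \<ge> 1" by linarith
    thus ?thesis using P by (intro mult_left_mono card_S) auto
  qed simp
  finally show ?thesis .
qed

text \<open>If the limsup were below 1, the ratio would eventually stay below some r < 1. Dividing
  the averaged inequality by X^(1 + 1/c) and letting X grow gives \<eta> - 3\<kappa> <= \<eta> r (1
  + \<eta>)^(1/c), which the choice of \<eta> and \<kappa> rules out.\<close>

lemma limsup_Upsilon_ge_1:
  assumes theta: "(\<lambda>n. cheb_theta n / n) \<longlonglongrightarrow> 1" and c: "c > 0"
  shows "limsup (\<lambda>N :: nat. ereal (real (Upsilon c N) / (c * real N powr (1 / c) / (ln (real N))\<^sup>2))) \<ge> 1"
proof (rule ccontr)
  assume "\<not> ?thesis"
  then obtain r0 where r0: "limsup (\<lambda>N :: nat. ereal (real (Upsilon c N) / (c * real N powr (1 / c) / (ln (real N))\<^sup>2))) < ereal r0" "ereal r0 < 1"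
    by (auto simp: not_le dest: ereal_dense2)
  \<comment> \<open>The maximum with 0 provides the sign needed for monotonicity in the later
    estimates.\<close>
  define r where "r = max r0 0"
  have r: "0 \<le> r" "r < 1" using r0 by (auto simp: r_def)
  from Limsup_lessD[OF r0(1)] obtain N0 where N0: "\<And>N. N \<ge> N0 \<Longrightarrow>
      real (Upsilon c N) / (c * real N powr (1 / c) / (ln (real N))\<^sup>2) < r0"
    by (auto simp: eventually_sequentially)
  have U: "real (Upsilon c N) \<le> r * (c * real N powr (1 / c) / (ln (real N))\<^sup>2)" if "N \<ge> N0" "N \<ge> 2" for N
  proof -
    have "c * real N powr (1 / c) / (ln (real N))\<^sup>2 > 0" using that c by simp
    from N0[OF that(1), unfolded pos_divide_less_eq[OF this]]
    have "real (Upsilon c N) \<le> r0 * (c * real N powr (1 / c) / (ln (real N))\<^sup>2)"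
      by (rule less_imp_le)
    also have "\<dots> \<le> r * (c * real N powr (1 / c) / (ln (real N))\<^sup>2)"
      using c by (intro mult_right_mono) (auto simp: r_def)
    finally show ?thesis .
  qed

  \<comment> \<open>The growth of N^(1/c) across the window costs a factor (1 + \<eta>)^(1/c);
    \<eta> is taken so small that r times this factor stays below (1 + r) / 2.\<close>
  have "((\<lambda>\<eta>. r * (1 + \<eta>) powr (1 / c)) \<longlongrightarrow> r * (1 + 0) powr (1 / c)) (at_right 0)"
    by (intro tendsto_intros) auto
  hence "\<forall>\<^sub>F \<eta> in at_right 0. r * (1 + \<eta>) powr (1 / c) < (1 + r) / 2"
    using r by (intro order_tendstoD) auto
  moreover have "\<forall>\<^sub>F \<eta> in at_right 0. \<eta> \<in> {0<..<1::real}" by (rule eventually_at_right_real) simp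
  ultimately have "\<exists>\<eta>. r * (1 + \<eta>) powr (1 / c) < (1 + r) / 2 \<and> \<eta> \<in> {0<..<1}"
    using eventually_happens[OF eventually_conj] by fastforce
  then obtain \<eta> where \<eta>: "0 < \<eta>" "\<eta> < 1" "r * (1 + \<eta>) powr (1 / c) < (1 + r) / 2" by auto
  \<comment> \<open>Chosen so that \<eta> - 3\<kappa> = \<eta> (1 + r) / 2. The 3 arises because the
    errors at y and y + W together are at most \<kappa> (2y + W) + 2K, with y and W at most
    X.\<close>
  define \<kappa> where "\<kappa> = \<eta> * (1 - r) / 6"
  have \<kappa>: "\<kappa> > 0" using \<eta> r by (simp add: \<kappa>_def)
  obtain K where K: "K \<ge> 0" "\<And>n. \<bar>cheb_theta n - n\<bar> \<le> \<kappa> * n + K"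
    using affine_bound_if_asymptotic_id[OF theta \<kappa>] by blast

  define W where "W = (\<lambda>X. nat \<lfloor>\<eta> * real X\<rfloor>)"
  define P where "P = (\<lambda>X. nat \<lfloor>real X powr (1 / c)\<rfloor>)"
  have W_lim: "(\<lambda>X. real (W X) / real X) \<longlonglongrightarrow> \<eta>"
    unfolding W_def using \<eta> by real_asymp
  have P_lim: "(\<lambda>X. real (P X) / real X powr (1 / c)) \<longlonglongrightarrow> 1"
    unfolding P_def using c by real_asymp
  have P_top: "filterlim P at_top at_top"
    unfolding P_def using c by real_asymp
  have theta_P: "(\<lambda>X. cheb_theta (P X) / real X powr (1 / c)) \<longlonglongrightarrow> 1"
  proof -
    have "(\<lambda>X. cheb_theta (P X) / real (P X) * (real (P X) / real X powr (1 / c))) \<longlonglongrightarrow> 1 * 1"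
      by (intro tendsto_mult P_lim filterlim_compose[OF theta P_top])
    moreover have "\<forall>\<^sub>F X in sequentially. cheb_theta (P X) / real (P X) * (real (P X) / real X powr (1 / c)) = cheb_theta (P X) / real X powr (1 / c)"
      using eventually_compose_filterlim[OF eventually_gt_at_top[of 0] P_top] by eventually_elim auto
    ultimately show ?thesis using Lim_transform_eventually by fastforce
  qed

  have main: "\<forall>\<^sub>F X in sequentially.
     cheb_theta (P X) / real X powr (1 / c) * (real (W X) / X - 3 * \<kappa> - 2 * K / X) \<le>
     real (W X) / X * (r * (1 + real (W X) / X) powr (1 / c)) * (ln (2 * real X) / ln X)"
    using eventually_ge_at_top[of N0] eventually_ge_at_top[of 2] 
       eventually_compose_filterlim[OF eventually_ge_at_top[of 1] P_top]
  proof eventually_elim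
    case (elim X)
    have lnX: "ln (real X) > 0" using elim by simp
    have WX: "W X \<le> X" unfolding W_def using \<eta> elim by (simp add: floor_le_iff nat_le_iff) (smt (verit) mult_left_le_one_le of_nat_0_le_iff)
    have PX: "real (P X) \<le> real X powr (1 / c)" unfolding P_def by (rule of_nat_floor) simp
    have "real (W X) - 3 * \<kappa> * X - 2 * K \<le> cheb_theta (y + W X) - cheb_theta y" if y: "y \<le> X" for y
    proof -
      have "\<kappa> * real (y + W X) + \<kappa> * real y \<le> \<kappa> * (3 * X)"
        unfolding distrib_left [symmetric] using y WX \<kappa> by (intro mult_left_mono) linarith+
      thus ?thesis using K(2)[of "y + W X"] K(2)[of y] unfolding of_nat_add by linarith
    qed
    hence "cheb_theta (P X) * (real (W X) - 3 * \<kappa> * X - 2 * K) \<le> 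
       ln (P X) * ln (real (X + W X)) * (\<Sum>N\<in>{X<..X + W X}. real (Upsilon c N))"
      by (intro theta_le_sum_Upsilon c PX elim) auto
    \<comment> \<open>The factor 1 / c from ln P <= ln X / c will cancel the c in the bound for
      \<open>Upsilon\<close>. Since X < N <= X + W, numerator and denominator of that bound are
      estimated at opposite ends of the window.\<close>
    also have "\<dots> \<le> (ln X / c) * ln (2 * real X) * (\<Sum>N\<in>{X<..X + W X}. r * (c * real (X + W X) powr (1 / c) / (ln X)\<^sup>2))"
    proof (intro mult_mono sum_mono)
      have "ln (real (P X)) \<le> ln (real X powr (1 / c))"
        by (subst ln_le_cancel_iff) (use PX elim in auto)
      thus "ln (real (P X)) \<le> ln X / c" using elim by (simp add: ln_powr)
      show "ln (real (X + W X)) \<le> ln (2 * real X)" using WX elim by simp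
      fix N assume N: "N \<in> {X<..X + W X}"
      have "real (Upsilon c N) \<le> r * (c * real N powr (1 / c) / (ln (real N))\<^sup>2)"
        using N elim by (intro U) auto
      also have "\<dots> \<le> r * (c * real (X + W X) powr (1 / c) / (ln X)\<^sup>2)"
        using N elim c r lnX by (intro mult_left_mono frac_le powr_mono2 power_mono) auto
      finally show "real (Upsilon c N) \<le> r * (c * real (X + W X) powr (1 / c) / (ln X)\<^sup>2)" .
    qed (use elim c lnX in \<open>auto intro!: sum_nonneg mult_nonneg_nonneg\<close>)
    also have "\<dots> = real (W X) * (r * real (X + W X) powr (1 / c)) * (ln (2 * real X) / ln X)"
      using c lnX by (simp add: power2_eq_square)
    also have "real (X + W X) = real X * (1 + real (W X) / X)"
      using elim by (simp add: distrib_left)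
    also have "\<dots> powr (1 / c) = real X powr (1 / c) * (1 + real (W X) / X) powr (1 / c)"
      by (rule powr_mult)
    finally have "cheb_theta (P X) * (real (W X) - 3 * \<kappa> * X - 2 * K) / (real X powr (1 / c) * X) \<le>
      real (W X) * (r * (real X powr (1 / c) * (1 + real (W X) / X) powr (1 / c))) * (ln (2 * real X) / ln X) / (real X powr (1 / c) * X)"
      by (intro divide_right_mono) auto
    moreover have "cheb_theta (P X) * (real (W X) - 3 * \<kappa> * X - 2 * K) / (real X powr (1 / c) * X) = 
       cheb_theta (P X) / real X powr (1 / c) * (real (W X) / X - 3 * \<kappa> - 2 * K / X)"
      using elim by (simp add: field_simps)
    moreover have "real (W X) * (r * (real X powr (1 / c) * (1 + real (W X) / X) powr (1 / c))) * (ln (2 * real X) / ln X) / (real X powr (1 / c) * X)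
       = real (W X) / X * (r * (1 + real (W X) / X) powr (1 / c)) * (ln (2 * real X) / ln X)"
      using elim by (simp add: mult_ac)
    ultimately show ?case by simp
  qed
  have "1 * (\<eta> - 3 * \<kappa> - 0) \<le> \<eta> * (r * (1 + \<eta>) powr (1 / c)) * 1"
  proof (rule tendsto_le[OF _ _ _ main])
    have "(\<lambda>X. 2 * K / real X) \<longlonglongrightarrow> 0" by real_asymp
    thus "(\<lambda>X. cheb_theta (P X) / real X powr (1 / c) * (real (W X) / X - 3 * \<kappa> - 2 * K / X)) \<longlonglongrightarrow> 1 * (\<eta> - 3 * \<kappa> - 0)"
      by (intro tendsto_intros theta_P W_lim)
    have "(\<lambda>X. ln (2 * real X) / ln (real X)) \<longlonglongrightarrow> 1" by real_asymp
    thus "(\<lambda>X. real (W X) / X * (r * (1 + real (W X) / X) powr (1 / c)) * (ln (2 * real X) / ln X)) \<longlonglongrightarrow> \<eta> * (r * (1 + \<eta>) powr (1 / c)) * 1"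
      using \<eta> by (intro tendsto_intros W_lim) auto
  qed simp
  hence "\<eta> * ((1 + r) / 2) \<le> \<eta> * (r * (1 + \<eta>) powr (1 / c))"
    by (simp add: \<kappa>_def field_simps)
  thus False using \<eta> by simp
qed

theorem theorem4:
  shows "AE c in (lebesgue :: real measure). c > 0 \<and> c \<notin> \<int> \<longrightarrow>
    limsup (\<lambda>N :: nat. ereal (real (Upsilon c N) / (c * real N powr (1 / c) / (ln (real N))\<^sup>2))) \<ge> 1"
  using limsup_Upsilon_ge_1[OF prime_number_theorem] by (intro AE_I2) simp

end
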